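(* Let $M$ be the monoid defined by the presentation $\langle A\mid R\rangle$, and let $\Gamma_0=(V_0,E_0)$ and $\Gamma_1=(V_1,E_1)$ be finite word graphs over $A$ representing right congruences $\rho_0$ and $\rho_1$ of $M$, respectively. Then the word graph $(\Gamma_0\sqcup\Gamma_1)/\kappa$ returned by the algorithm JoinWordGraphs applied to $\Gamma_0$ and $\Gamma_1$ represents (with distinguished node $0_{\Gamma_0}/\kappa$ in the role of $0$) the join $\rho_0\vee\rho_1$ of $\rho_0$ and $\rho_1$.
   Context: Functions are written to the right of their arguments. $A$ is a finite alphabet, $A^*$ the free monoid on $A$ with identity the empty word $\varepsilon$, $R\subseteq A^*\times A^*$, $R^{\#}$ the least 2-sided congruence on $A^*$ containing $R$, $M\cong A^*/R^{\#}$, and $\theta:A^*\to M$ the natural surjective homomorphism with $\ker(\theta)=R^{\#}$. For $T\subseteq A^*\times A^*$ write $(T)\theta=\{((u)\theta,(v)\theta):(u,v)\in T\}$. The join $\rho_0\vee\rho_1$ is the least right congruence on $M$ containing $\rho_0\cup\rho_1$. A word graph over $A$ is a digraph $\Gamma=(V,E)$ with $E\subseteq V\times A\times V$. It is complete (respectively deterministic) if for every node $\alpha$ and $a\in A$ there is at least (respectively at most) one edge with source $\alpha$ and label $a$. Write $\alpha\cdot u=\beta$ if $u\in A^*$ labels a path from $\alpha$ to $\beta$ (the empty path being labelled by $\varepsilon$), and $\alpha\cdot u=\bot$ if $u$ labels no path with source $\alpha$; $(\alpha)\pi_\Gamma=\{(u,v):\alpha\cdot u\ne\bot,\ \alpha\cdot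 u=\alpha\cdot v\}$. $\Gamma$ is compatible with $R$ if for all $(u,v)\in R$ and $\alpha\in V$, $\alpha\cdot u=\alpha\cdot v$ whenever both are $\neq\bot$. A word graph $\Gamma$ with distinguished node $0$ represents the right congruence $\rho$ of $M$ if $\Gamma$ is complete, deterministic, compatible with $R$, every node is reachable from $0$, and $\rho=((0)\pi_\Gamma)\theta$. $\Gamma_0\sqcup\Gamma_1$ denotes the disjoint union, with nodes $V_0\sqcup V_1$ and edges $E_0\sqcup E_1$; the node $0$ of $\Gamma_i$ is written $0_{\Gamma_i}$. For an equivalence relation $\kappa$ on the nodes of $\Gamma=(V,E)$, the quotient $\Gamma/\kappa$ has nodes the classes $\alpha/\kappa$ and edges $\{(\alpha/\kappa,a,\beta/\kappa):(\alpha,a,\beta)\in E\}$. Algorithm JoinWordGraphs. Maintain a partition (equivalence relation) $\kappa$ of $V_0\sqcup V_1$, initially equality, in which every part has a chosen canonical representative; $\mathrm{Find}(\kappa,\alpha)$ returns the representative of the part containing $\alpha$, and $\mathrm{Union}(\kappa,\alpha,\beta)$ merges the parts of $\alpha$ and $\beta$. Push $(0_{\Gamma_0},0_{\Gamma_1})$ onto an empty stack $S$ and perform $\mathrm{Union}(\kappa,0_{\Gamma_0},0_{\Gamma_1})$. While $S$ is non-empty: pop a pair $(\alpha_0,\alpha_1)$ from $S$; for each $a\in A$, let $\alpha_0',\alpha_1'$ be the nodes with $(\alpha_0,a,\alpha_0'),(\alpha_1,a,\alpha_1')\in E_0\sqcup E_1$, let $\gamma_0=\mathrm{Find}(\kappa,\alpha_0')$,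 $\gamma_1=\mathrm{Find}(\kappa,\alpha_1')$, and if $\gamma_0\neq\gamma_1$, push $(\gamma_0,\gamma_1)$ onto $S$ and perform $\mathrm{Union}(\kappa,\gamma_0,\gamma_1)$. When $S$ is empty, return $(\Gamma_0\sqcup\Gamma_1)/\kappa$ for the final $\kappa$. *)

theory Defs
  imports "HOL-Algebra.Group"
begin

definition free_monoid :: "'a set \<Rightarrow> 'a list monoid" where
  "free_monoid A = \<lparr>carrier = lists A, mult = (@), one = []\<rparr>"

definition right_congruence :: "('m, 'x) monoid_scheme \<Rightarrow> ('m \<times> 'm) set \<Rightarrow> bool" where
  "right_congruence M r \<longleftrightarrow> equiv (carrier M) r \<and>
     (\<forall>(x, y) \<in> r. \<forall>s \<in> carrier M. (x \<otimes>\<^bsub>M\<^esub> s, y \<otimes>\<^bsub>M\<^esub> s) \<in> r)"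

definition two_sided_congruence :: "('m, 'x) monoid_scheme \<Rightarrow> ('m \<times> 'm) set \<Rightarrow> bool" where
  "two_sided_congruence M r \<longleftrightarrow> right_congruence M r \<and>
     (\<forall>(x, y) \<in> r. \<forall>s \<in> carrier M. (s \<otimes>\<^bsub>M\<^esub> x, s \<otimes>\<^bsub>M\<^esub> y) \<in> r)"

definition least_two_sided_congruence :: "('m, 'x) monoid_scheme \<Rightarrow> ('m \<times> 'm) set \<Rightarrow> ('m \<times> 'm) set" where
  "least_two_sided_congruence M T = \<Inter> {r. two_sided_congruence M r \<and> T \<subseteq> r}"

definition right_congruence_join ::
    "('m, 'x) monoid_scheme \<Rightarrow> ('m \<times> 'm) set \<Rightarrow> ('m \<times> 'm) set \<Rightarrow> ('m \<times> 'm) set" where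
  "right_congruence_join M \<rho>\<^sub>0 \<rho>\<^sub>1 = \<Inter> {r. right_congruence M r \<and> \<rho>\<^sub>0 \<union> \<rho>\<^sub>1 \<subseteq> r}"

text \<open>A presented monoid is only determined up to isomorphism, so it is given here as any monoid
  \<open>M\<close> together with a surjective homomorphism \<open>\<theta>\<close> from the free monoid whose kernel is the
  congruence generated by \<open>R\<close>. Preservation of the identity is listed separately because
  \<^const>\<open>hom\<close> does not include it.\<close>

definition presented_by ::
    "'a set \<Rightarrow> ('a list \<times> 'a list) set \<Rightarrow> ('m, 'x) monoid_scheme \<Rightarrow> ('a list \<Rightarrow> 'm) \<Rightarrow> bool" where
  "presented_by A R M \<theta> \<longleftrightarrow>
     monoid M \<and> \<theta> \<in> hom (free_monoid A) M \<and> \<theta> [] = \<one>\<^bsub>M\<^esub> \<and> \<theta> ` lists A = carrier M \<and>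
     {(u, v). u \<in> lists A \<and> v \<in> lists A \<and> \<theta> u = \<theta> v} = least_two_sided_congruence (free_monoid A) R"

record ('v, 'a) word_graph =
  nodes :: "'v set"
  edges :: "('v \<times> 'a \<times> 'v) set"

definition word_graph_over :: "'a set \<Rightarrow> ('v, 'a) word_graph \<Rightarrow> bool" where
  "word_graph_over A \<Gamma> \<longleftrightarrow> edges \<Gamma> \<subseteq> nodes \<Gamma> \<times> A \<times> nodes \<Gamma>"

definition complete_wg :: "'a set \<Rightarrow> ('v, 'a) word_graph \<Rightarrow> bool" where
  "complete_wg A \<Gamma> \<longleftrightarrow> (\<forall>\<alpha> \<in> nodes \<Gamma>. \<forall>a \<in> A. \<exists>\<beta>. (\<alpha>, a, \<beta>) \<in> edges \<Gamma>)"

definition deterministic_wg :: "('v, 'a) word_graph \<Rightarrow> bool" where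
  "deterministic_wg \<Gamma> \<longleftrightarrow>
     (\<forall>\<alpha> a \<beta> \<beta>'. (\<alpha>, a, \<beta>) \<in> edges \<Gamma> \<longrightarrow> (\<alpha>, a, \<beta>') \<in> edges \<Gamma> \<longrightarrow> \<beta> = \<beta>')"

text \<open>\<open>path_to \<Gamma> \<alpha> u \<beta>\<close> is \<open>\<alpha> \<cdot> u = \<beta>\<close>. The value \<open>\<alpha> \<cdot> u\<close> is undefined when there is no such
  \<open>\<beta>\<close>, and it is a well-defined node only if the graph is deterministic; keeping \<open>\<cdot>\<close> relational
  avoids a default value.\<close>

inductive path_to :: "('v, 'a) word_graph \<Rightarrow> 'v \<Rightarrow> 'a list \<Rightarrow> 'v \<Rightarrow> bool" for \<Gamma> where
  Nil: "\<alpha> \<in> nodes \<Gamma> \<Longrightarrow> path_to \<Gamma> \<alpha> [] \<alpha>"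
| Cons: "(\<alpha>, a, \<beta>) \<in> edges \<Gamma> \<Longrightarrow> path_to \<Gamma> \<beta> u \<gamma> \<Longrightarrow> path_to \<Gamma> \<alpha> (a # u) \<gamma>"

definition path_rel :: "('v, 'a) word_graph \<Rightarrow> 'v \<Rightarrow> ('a list \<times> 'a list) set" where
  "path_rel \<Gamma> \<alpha> = {(u, v). \<exists>\<beta>. path_to \<Gamma> \<alpha> u \<beta> \<and> path_to \<Gamma> \<alpha> v \<beta>}"

definition compatible :: "('a list \<times> 'a list) set \<Rightarrow> ('v, 'a) word_graph \<Rightarrow> bool" where
  "compatible R \<Gamma> \<longleftrightarrow>
     (\<forall>(u, v) \<in> R. \<forall>\<alpha> \<in> nodes \<Gamma>. \<forall>\<beta> \<beta>'. path_to \<Gamma> \<alpha> u \<beta> \<longrightarrow> path_to \<Gamma> \<alpha> v \<beta>' \<longrightarrow> \<beta> = \<beta>')"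

definition represents ::
    "'a set \<Rightarrow> ('a list \<times> 'a list) set \<Rightarrow> ('m, 'x) monoid_scheme \<Rightarrow> ('a list \<Rightarrow> 'm) \<Rightarrow>
     ('v, 'a) word_graph \<Rightarrow> 'v \<Rightarrow> ('m \<times> 'm) set \<Rightarrow> bool" where
  "represents A R M \<theta> \<Gamma> z \<rho> \<longleftrightarrow>
     right_congruence M \<rho> \<and>
     word_graph_over A \<Gamma> \<and> z \<in> nodes \<Gamma> \<and>
     complete_wg A \<Gamma> \<and> deterministic_wg \<Gamma> \<and> compatible R \<Gamma> \<and>
     (\<forall>\<alpha> \<in> nodes \<Gamma>. \<exists>u. path_to \<Gamma> z u \<alpha>) \<and>
     \<rho> = map_prod \<theta> \<theta> ` path_rel \<Gamma> z"

definition wg_union :: "('v, 'a) word_graph \<Rightarrow> ('w, 'a) word_graph \<Rightarrow> ('v + 'w, 'a) word_graph" where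
  "wg_union \<Gamma>\<^sub>0 \<Gamma>\<^sub>1 =
     \<lparr>nodes = nodes \<Gamma>\<^sub>0 <+> nodes \<Gamma>\<^sub>1,
      edges = {(Inl \<alpha>, a, Inl \<beta>) | \<alpha> a \<beta>. (\<alpha>, a, \<beta>) \<in> edges \<Gamma>\<^sub>0} \<union>
              {(Inr \<alpha>, a, Inr \<beta>) | \<alpha> a \<beta>. (\<alpha>, a, \<beta>) \<in> edges \<Gamma>\<^sub>1}\<rparr>"

definition wg_quotient :: "('v, 'a) word_graph \<Rightarrow> ('v \<times> 'v) set \<Rightarrow> ('v set, 'a) word_graph" where
  "wg_quotient \<Gamma> \<kappa> =
     \<lparr>nodes = nodes \<Gamma> // \<kappa>,
      edges = {(\<kappa> `` {\<alpha>}, a, \<kappa> `` {\<beta>}) | \<alpha> a \<beta>. (\<alpha>, a, \<beta>) \<in> edges \<Gamma>}\<rparr>"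

text \<open>The algorithm leaves open which representatives are chosen and in which order the letters are
  visited. It is therefore modelled as a transition relation: after each Union the representative
  function may be any valid one for the new partition, and each pass through the letters may use
  any enumeration of the alphabet.\<close>

record 'n join_state =
  partn :: "('n \<times> 'n) set"
  find :: "'n \<Rightarrow> 'n"
  stack :: "('n \<times> 'n) list"

definition valid_find :: "'n set \<Rightarrow> ('n \<times> 'n) set \<Rightarrow> ('n \<Rightarrow> 'n) \<Rightarrow> bool" where
  "valid_find V \<kappa> f \<longleftrightarrow> (\<forall>\<alpha> \<in> V. (\<alpha>, f \<alpha>) \<in> \<kappa>) \<and> (\<forall>(\<alpha>, \<beta>) \<in> \<kappa>. f \<alpha> = f \<beta>)"

definition merge_parts :: "('n \<times> 'n) set \<Rightarrow> 'n \<Rightarrow> 'n \<Rightarrow> ('n \<times> 'n) set" where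
  "merge_parts \<kappa> \<alpha> \<beta> = \<kappa> \<union> \<kappa> `` {\<alpha>} \<times> \<kappa> `` {\<beta>} \<union> \<kappa> `` {\<beta>} \<times> \<kappa> `` {\<alpha>}"

definition push_union :: "'n set \<Rightarrow> 'n \<Rightarrow> 'n \<Rightarrow> 'n join_state \<Rightarrow> 'n join_state \<Rightarrow> bool" where
  "push_union V \<alpha> \<beta> s s' \<longleftrightarrow>
     stack s' = (\<alpha>, \<beta>) # stack s \<and>
     partn s' = merge_parts (partn s) \<alpha> \<beta> \<and>
     valid_find V (partn s') (find s')"

definition join_init :: "'n set \<Rightarrow> 'n \<Rightarrow> 'n \<Rightarrow> 'n join_state \<Rightarrow> bool" where
  "join_init V z\<^sub>0 z\<^sub>1 s \<longleftrightarrow>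
     (\<exists>f. valid_find V (Id_on V) f \<and>
          push_union V z\<^sub>0 z\<^sub>1 \<lparr>partn = Id_on V, find = f, stack = []\<rparr> s)"

definition letter_step ::
    "('n, 'a) word_graph \<Rightarrow> 'n \<Rightarrow> 'n \<Rightarrow> 'a \<Rightarrow> 'n join_state \<Rightarrow> 'n join_state \<Rightarrow> bool" where
  "letter_step \<Gamma> \<alpha>\<^sub>0 \<alpha>\<^sub>1 a s s' \<longleftrightarrow>
     (\<exists>\<alpha>\<^sub>0' \<alpha>\<^sub>1'. (\<alpha>\<^sub>0, a, \<alpha>\<^sub>0') \<in> edges \<Gamma> \<and> (\<alpha>\<^sub>1, a, \<alpha>\<^sub>1') \<in> edges \<Gamma> \<and>
        (let \<gamma>\<^sub>0 = find s \<alpha>\<^sub>0'; \<gamma>\<^sub>1 = find s \<alpha>\<^sub>1'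
         in if \<gamma>\<^sub>0 \<noteq> \<gamma>\<^sub>1 then push_union (nodes \<Gamma>) \<gamma>\<^sub>0 \<gamma>\<^sub>1 s s' else s' = s))"

inductive letter_steps ::
    "('n, 'a) word_graph \<Rightarrow> 'n \<Rightarrow> 'n \<Rightarrow> 'a list \<Rightarrow> 'n join_state \<Rightarrow> 'n join_state \<Rightarrow> bool"
  for \<Gamma> \<alpha>\<^sub>0 \<alpha>\<^sub>1 where
  Nil: "letter_steps \<Gamma> \<alpha>\<^sub>0 \<alpha>\<^sub>1 [] s s"
| Cons: "letter_step \<Gamma> \<alpha>\<^sub>0 \<alpha>\<^sub>1 a s s' \<Longrightarrow> letter_steps \<Gamma> \<alpha>\<^sub>0 \<alpha>\<^sub>1 as s' s'' \<Longrightarrow>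
         letter_steps \<Gamma> \<alpha>\<^sub>0 \<alpha>\<^sub>1 (a # as) s s''"

definition join_step ::
    "'a set \<Rightarrow> ('n, 'a) word_graph \<Rightarrow> 'n join_state \<Rightarrow> 'n join_state \<Rightarrow> bool" where
  "join_step A \<Gamma> s s' \<longleftrightarrow>
     (\<exists>\<alpha>\<^sub>0 \<alpha>\<^sub>1 S as. stack s = (\<alpha>\<^sub>0, \<alpha>\<^sub>1) # S \<and> distinct as \<and> set as = A \<and>
        letter_steps \<Gamma> \<alpha>\<^sub>0 \<alpha>\<^sub>1 as (s\<lparr>stack := S\<rparr>) s')"

definition join_reachable ::
    "'a set \<Rightarrow> ('v, 'a) word_graph \<Rightarrow> 'v \<Rightarrow> ('w, 'a) word_graph \<Rightarrow> 'w \<Rightarrow> ('v + 'w) join_state \<Rightarrow> bool" where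
  "join_reachable A \<Gamma>\<^sub>0 z\<^sub>0 \<Gamma>\<^sub>1 z\<^sub>1 s \<longleftrightarrow>
     (\<exists>s\<^sub>0. join_init (nodes (wg_union \<Gamma>\<^sub>0 \<Gamma>\<^sub>1)) (Inl z\<^sub>0) (Inr z\<^sub>1) s\<^sub>0 \<and>
           (join_step A (wg_union \<Gamma>\<^sub>0 \<Gamma>\<^sub>1))\<^sup>*\<^sup>* s\<^sub>0 s)"

text \<open>Some run of the algorithm stops with the final partition \<open>\<kappa>\<close>, so that it returns
  \<open>wg_quotient (wg_union \<Gamma>\<^sub>0 \<Gamma>\<^sub>1) \<kappa>\<close>.\<close>

definition join_final_partition ::
    "'a set \<Rightarrow> ('v, 'a) word_graph \<Rightarrow> 'v \<Rightarrow> ('w, 'a) word_graph \<Rightarrow> 'w \<Rightarrow>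
     (('v + 'w) \<times> ('v + 'w)) set \<Rightarrow> bool" where
  "join_final_partition A \<Gamma>\<^sub>0 z\<^sub>0 \<Gamma>\<^sub>1 z\<^sub>1 \<kappa> \<longleftrightarrow>
     (\<exists>s. join_reachable A \<Gamma>\<^sub>0 z\<^sub>0 \<Gamma>\<^sub>1 z\<^sub>1 s \<and> stack s = [] \<and> partn s = \<kappa>)"

text \<open>Every run returns: a run can be started, no run is infinite, and no run gets stuck while the
  stack is non-empty.\<close>

definition join_terminates ::
    "'a set \<Rightarrow> ('v, 'a) word_graph \<Rightarrow> 'v \<Rightarrow> ('w, 'a) word_graph \<Rightarrow> 'w \<Rightarrow> bool" where
  "join_terminates A \<Gamma>\<^sub>0 z\<^sub>0 \<Gamma>\<^sub>1 z\<^sub>1 \<longleftrightarrow>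
     (\<exists>s. join_reachable A \<Gamma>\<^sub>0 z\<^sub>0 \<Gamma>\<^sub>1 z\<^sub>1 s) \<and>
     (\<nexists>s :: nat \<Rightarrow> ('v + 'w) join_state. join_reachable A \<Gamma>\<^sub>0 z\<^sub>0 \<Gamma>\<^sub>1 z\<^sub>1 (s 0) \<and>
        (\<forall>i. join_step A (wg_union \<Gamma>\<^sub>0 \<Gamma>\<^sub>1) (s i) (s (Suc i)))) \<and>
     (\<forall>s. join_reachable A \<Gamma>\<^sub>0 z\<^sub>0 \<Gamma>\<^sub>1 z\<^sub>1 s \<longrightarrow> stack s \<noteq> [] \<longrightarrow>
        (\<exists>s'. join_step A (wg_union \<Gamma>\<^sub>0 \<Gamma>\<^sub>1) s s'))"

end

theory Submission
  imports Defs
begin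

text \<open>Call an equivalence on the nodes of a word graph right-invariant if related nodes have
  related targets along every letter. The theorem has two halves that meet in this notion.

  The algorithm computes the least right-invariant equivalence \<open>\<kappa>\<close> on the disjoint union that
  relates the two initial nodes. Every Union is forced: it merges targets of nodes that are already
  related, so any right-invariant equivalence relating the initial nodes contains the current
  partition. Conversely, right-invariance of the current partition can fail only because of the
  pairs still on the stack: merging the parts of \<open>\<gamma>\<^sub>0\<close> and \<open>\<gamma>\<^sub>1\<close> creates many new related pairs, but
  their targets are joined by a chain through the targets of \<open>\<gamma>\<^sub>0\<close> and \<open>\<gamma>\<^sub>1\<close>, so that it is enough
  to process this one pair. Both facts are part of \<open>join_invariant\<close>, and \<open>final_partition\<close>
  reads off the result once the stack is empty. Runs are finite because each Union strictly
  enlarges the partition and each pass without a Union shortens the stack.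

  The quotient by \<open>\<kappa>\<close> is again complete, deterministic and compatible with the relations, so the pairs
  of words leading from its initial node to a common node give a right congruence of the monoid
  (\<open>right_congruence_path_rel\<close>). It contains both given right congruences, since paths survive
  in the quotient, and hence it contains their join. In the other direction, a right congruence \<open>r\<close> above
  both given ones induces a relation on nodes: two nodes are related if the words reaching them
  are \<open>r\<close>-related. This relation is right-invariant and relates the initial nodes
  (\<open>pullback_right_invariant\<close>), so it contains \<open>\<kappa>\<close> by leastness. Two words that lead to the same node
  of the quotient are therefore \<open>r\<close>-related, and thus related by the join.\<close>

section \<open>Paths in complete deterministic word graphs\<close>

lemma path_to_append:
  "path_to \<Gamma> \<alpha> u \<beta> \<Longrightarrow> path_to \<Gamma> \<beta> v \<gamma> \<Longrightarrow> path_to \<Gamma> \<alpha> (u @ v) \<gamma>"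
  by (induction rule: path_to.induct) (auto intro: path_to.intros)

lemma path_to_snoc:
  "path_to \<Gamma> \<alpha> u \<beta> \<Longrightarrow> (\<beta>, a, \<gamma>) \<in> edges \<Gamma> \<Longrightarrow> \<gamma> \<in> nodes \<Gamma> \<Longrightarrow> path_to \<Gamma> \<alpha> (u @ [a]) \<gamma>"
  by (rule path_to_append[OF _ path_to.Cons[OF _ path_to.Nil]])

locale complete_det_graph =
  fixes A :: "'a set" and \<Gamma> :: "('n, 'a) word_graph"
  assumes over: "word_graph_over A \<Gamma>"
    and complete: "complete_wg A \<Gamma>"
    and det: "deterministic_wg \<Gamma>"
begin

lemma edge_in: "(\<alpha>, a, \<beta>) \<in> edges \<Gamma> \<Longrightarrow> \<alpha> \<in> nodes \<Gamma> \<and> a \<in> A \<and> \<beta> \<in> nodes \<Gamma>"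
  using over by (auto simp: word_graph_over_def)

lemma edge_exists: "\<alpha> \<in> nodes \<Gamma> \<Longrightarrow> a \<in> A \<Longrightarrow> \<exists>\<beta>. (\<alpha>, a, \<beta>) \<in> edges \<Gamma>"
  using complete by (auto simp: complete_wg_def)

lemma edge_unique: "(\<alpha>, a, \<beta>) \<in> edges \<Gamma> \<Longrightarrow> (\<alpha>, a, \<beta>') \<in> edges \<Gamma> \<Longrightarrow> \<beta> = \<beta>'"
  using det by (auto simp: deterministic_wg_def)

lemma path_in: "path_to \<Gamma> \<alpha> u \<beta> \<Longrightarrow> \<alpha> \<in> nodes \<Gamma> \<and> u \<in> lists A \<and> \<beta> \<in> nodes \<Gamma>"
  by (induction rule: path_to.induct) (auto dest: edge_in)

lemma path_exists: "\<alpha> \<in> nodes \<Gamma> \<Longrightarrow> u \<in> lists A \<Longrightarrow> \<exists>\<beta>. path_to \<Gamma> \<alpha> u \<beta>"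
proof (induction u arbitrary: \<alpha>)
  case Nil
  then show ?case by (auto intro: path_to.Nil)
next
  case (Cons a u)
  then obtain \<beta> where "(\<alpha>, a, \<beta>) \<in> edges \<Gamma>" using edge_exists[of \<alpha> a] by auto
  with Cons show ?case by (meson Cons_in_lists_iff edge_in path_to.Cons)
qed

lemma path_unique: "path_to \<Gamma> \<alpha> u \<beta> \<Longrightarrow> path_to \<Gamma> \<alpha> u \<beta>' \<Longrightarrow> \<beta> = \<beta>'"
proof (induction arbitrary: \<beta>' rule: path_to.induct)
  case (Nil \<alpha>)
  then show ?case by (auto elim: path_to.cases)
next
  case (Cons \<alpha> a \<beta> u \<gamma>)
  from Cons.prems obtain \<delta> where "(\<alpha>, a, \<delta>) \<in> edges \<Gamma>" "path_to \<Gamma> \<delta> u \<beta>'"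
    by (auto elim: path_to.cases)
  with Cons show ?case using edge_unique by blast
qed

lemma path_rel_trans:
  "(u, v) \<in> path_rel \<Gamma> \<alpha> \<Longrightarrow> (v, w) \<in> path_rel \<Gamma> \<alpha> \<Longrightarrow> (u, w) \<in> path_rel \<Gamma> \<alpha>"
  unfolding path_rel_def using path_unique by blast

lemma path_rel_append:
  assumes "(u, v) \<in> path_rel \<Gamma> \<alpha>" "w \<in> lists A"
  shows "(u @ w, v @ w) \<in> path_rel \<Gamma> \<alpha>"
proof -
  from assms obtain \<beta> where b: "path_to \<Gamma> \<alpha> u \<beta>" "path_to \<Gamma> \<alpha> v \<beta>"
    by (auto simp: path_rel_def)
  moreover obtain \<gamma> where "path_to \<Gamma> \<beta> w \<gamma>" using path_exists path_in assms b by blast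
  ultimately show ?thesis by (auto simp: path_rel_def intro: path_to_append)
qed

lemma path_rel_refl: "\<alpha> \<in> nodes \<Gamma> \<Longrightarrow> u \<in> lists A \<Longrightarrow> (u, u) \<in> path_rel \<Gamma> \<alpha>"
  using path_exists by (auto simp: path_rel_def)

text \<open>The pairs of words that act alike on all nodes form a two-sided congruence, and
  compatibility says that it contains the relations; hence the word graph is an action of the
  presented monoid, not merely of the free monoid.\<close>

lemma least_congruence_acts_trivially:
  assumes R: "R \<subseteq> lists A \<times> lists A" and compat: "compatible R \<Gamma>"
    and uv: "(u, v) \<in> least_two_sided_congruence (free_monoid A) R"
    and \<alpha>: "\<alpha> \<in> nodes \<Gamma>"
  shows "(u, v) \<in> path_rel \<Gamma> \<alpha>"
proof -
  define C where
    "C = {(u, v). u \<in> lists A \<and> v \<in> lists A \<and> (\<forall>\<alpha> \<in> nodes \<Gamma>. (u, v) \<in> path_rel \<Gamma> \<alpha>)}"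
  have "equiv (lists A) C"
  proof (rule equivI)
    show "C \<subseteq> lists A \<times> lists A" "refl_on (lists A) C"
      using path_rel_refl by (auto simp: C_def refl_on_def)
    show "sym C" by (auto simp: C_def sym_def path_rel_def)
    show "trans C" by (rule transI) (auto simp: C_def intro: path_rel_trans)
  qed
  moreover have "(s @ u, s @ v) \<in> C" if "(u, v) \<in> C" "s \<in> lists A" for u v s
  proof -
    have "(s @ u, s @ v) \<in> path_rel \<Gamma> \<alpha>" if "\<alpha> \<in> nodes \<Gamma>" for \<alpha>
    proof -
      obtain \<beta> where b: "path_to \<Gamma> \<alpha> s \<beta>" using path_exists \<open>\<alpha> \<in> nodes \<Gamma>\<close> \<open>s \<in> lists A\<close> by blast
      then have "(u, v) \<in> path_rel \<Gamma> \<beta>" using path_in \<open>(u, v) \<in> C\<close> by (auto simp: C_def)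
      with b show ?thesis by (auto simp: path_rel_def intro: path_to_append)
    qed
    with that show ?thesis by (auto simp: C_def)
  qed
  moreover have "(u @ s, v @ s) \<in> C" if "(u, v) \<in> C" "s \<in> lists A" for u v s
    using that path_rel_append by (auto simp: C_def)
  moreover have "carrier (free_monoid A) = lists A" "mult (free_monoid A) = (@)"
    by (simp_all add: free_monoid_def)
  ultimately have "two_sided_congruence (free_monoid A) C"
    unfolding two_sided_congruence_def right_congruence_def by (simp del: in_lists_conv_set) blast
  moreover have "R \<subseteq> C"
  proof clarify
    fix u v assume uv: "(u, v) \<in> R"
    then have words: "u \<in> lists A" "v \<in> lists A" using R by auto
    moreover have "(u, v) \<in> path_rel \<Gamma> \<alpha>" if node: "\<alpha> \<in> nodes \<Gamma>" for \<alpha>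
    proof -
      obtain \<beta> \<beta>' where p: "path_to \<Gamma> \<alpha> u \<beta>" "path_to \<Gamma> \<alpha> v \<beta>'"
        using path_exists[OF node] words by blast
      moreover have "\<beta> = \<beta>'" using compat uv node p unfolding compatible_def by blast
      ultimately show ?thesis by (auto simp: path_rel_def)
    qed
    ultimately show "(u, v) \<in> C" by (auto simp: C_def)
  qed
  ultimately have "(u, v) \<in> C" using uv by (auto simp: least_two_sided_congruence_def)
  with \<alpha> show ?thesis by (auto simp: C_def)
qed

end

lemma presented_by_append:
  assumes "presented_by A R M \<theta>" "u \<in> lists A" "v \<in> lists A"
  shows "\<theta> (u @ v) = \<theta> u \<otimes>\<^bsub>M\<^esub> \<theta> v"
  using assms by (auto simp: presented_by_def hom_def free_monoid_def)

lemma (in complete_det_graph) right_congruence_path_rel: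
  assumes R: "R \<subseteq> lists A \<times> lists A" and compat: "compatible R \<Gamma>"
    and pres: "presented_by A R M \<theta>" and z: "z \<in> nodes \<Gamma>"
  shows "right_congruence M (map_prod \<theta> \<theta> ` path_rel \<Gamma> z)"
proof -
  let ?\<rho> = "map_prod \<theta> \<theta> ` path_rel \<Gamma> z"
  have surj: "\<theta> ` lists A = carrier M" using pres by (simp add: presented_by_def)
  have words: "u \<in> lists A \<and> v \<in> lists A" if "(u, v) \<in> path_rel \<Gamma> z" for u v
    using that path_in by (auto simp: path_rel_def)
  have ker: "(u, v) \<in> path_rel \<Gamma> z" if "u \<in> lists A" "v \<in> lists A" "\<theta> u = \<theta> v" for u v
    using that least_congruence_acts_trivially[OF R compat _ z] pres
    unfolding presented_by_def by blast
  have "equiv (carrier M) ?\<rho>"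
  proof (rule equivI)
    show "?\<rho> \<subseteq> carrier M \<times> carrier M" using words surj by fastforce
    show "refl_on (carrier M) ?\<rho>"
      unfolding refl_on_def surj[symmetric] using path_rel_refl[OF z] by force
    show "sym ?\<rho>" by (fastforce simp: sym_def path_rel_def)
    show "trans ?\<rho>"
    proof (rule transI)
      fix x y w assume "(x, y) \<in> ?\<rho>" "(y, w) \<in> ?\<rho>"
      then obtain a b c d where ab: "(a, b) \<in> path_rel \<Gamma> z" "x = \<theta> a" "y = \<theta> b"
        and cd: "(c, d) \<in> path_rel \<Gamma> z" "y = \<theta> c" "w = \<theta> d"
        by auto
      \<comment> \<open>The two words for \<open>y\<close> may differ; they lead to the same node because they agree in \<open>M\<close>.\<close>
      have "(b, c) \<in> path_rel \<Gamma> z" using ker words ab cd by metis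
      then have "(a, d) \<in> path_rel \<Gamma> z" using path_rel_trans ab cd by blast
      then show "(x, w) \<in> ?\<rho>" using ab cd by auto
    qed
  qed
  moreover have "(x \<otimes>\<^bsub>M\<^esub> s, y \<otimes>\<^bsub>M\<^esub> s) \<in> ?\<rho>" if xy: "(x, y) \<in> ?\<rho>" and s: "s \<in> carrier M" for x y s
  proof -
    from xy obtain u v where uv: "(u, v) \<in> path_rel \<Gamma> z" "x = \<theta> u" "y = \<theta> v" by auto
    from s surj obtain w where w: "w \<in> lists A" "s = \<theta> w" by auto
    have "(\<theta> (u @ w), \<theta> (v @ w)) \<in> ?\<rho>" using path_rel_append[OF uv(1) w(1)] by force
    then show ?thesis using presented_by_append[OF pres] words[OF uv(1)] uv w by simp
  qed
  ultimately show ?thesis unfolding right_congruence_def by blast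
qed

section \<open>Quotients by right-invariant equivalences\<close>

definition targets_related ::
    "('n, 'a) word_graph \<Rightarrow> ('n \<times> 'n) set \<Rightarrow> 'n \<Rightarrow> 'n \<Rightarrow> 'a \<Rightarrow> bool" where
  "targets_related \<Gamma> \<kappa> \<alpha> \<beta> a \<longleftrightarrow>
     (\<forall>\<alpha>' \<beta>'. (\<alpha>, a, \<alpha>') \<in> edges \<Gamma> \<longrightarrow> (\<beta>, a, \<beta>') \<in> edges \<Gamma> \<longrightarrow> (\<alpha>', \<beta>') \<in> \<kappa>)"

definition right_invariant_equiv :: "('n, 'a) word_graph \<Rightarrow> ('n \<times> 'n) set \<Rightarrow> bool" where
  "right_invariant_equiv \<Gamma> \<kappa> \<longleftrightarrow>
     equiv (nodes \<Gamma>) \<kappa> \<and> (\<forall>(\<alpha>, \<beta>) \<in> \<kappa>. \<forall>a. targets_related \<Gamma> \<kappa> \<alpha> \<beta> a)"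

lemma path_to_wg_quotient:
  "path_to \<Gamma> \<alpha> u \<beta> \<Longrightarrow> path_to (wg_quotient \<Gamma> \<kappa>) (\<kappa> `` {\<alpha>}) u (\<kappa> `` {\<beta>})"
proof (induction rule: path_to.induct)
  case (Nil \<alpha>)
  then show ?case by (auto intro!: path_to.Nil simp: wg_quotient_def quotientI)
next
  case (Cons \<alpha> a \<beta> u \<gamma>)
  then have "(\<kappa> `` {\<alpha>}, a, \<kappa> `` {\<beta>}) \<in> edges (wg_quotient \<Gamma> \<kappa>)"
    by (auto simp: wg_quotient_def)
  with Cons.IH show ?case by (rule path_to.Cons[rotated])
qed

context complete_det_graph
begin

lemma complete_det_graph_quotient:
  assumes \<kappa>: "right_invariant_equiv \<Gamma> \<kappa>"
  shows "complete_det_graph A (wg_quotient \<Gamma> \<kappa>)"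
proof
  have eq: "equiv (nodes \<Gamma>) \<kappa>" using \<kappa> by (simp add: right_invariant_equiv_def)
  show "word_graph_over A (wg_quotient \<Gamma> \<kappa>)"
    using edge_in by (auto simp: word_graph_over_def wg_quotient_def intro: quotientI)
  show "complete_wg A (wg_quotient \<Gamma> \<kappa>)"
    unfolding complete_wg_def
  proof (intro ballI)
    fix X a assume "X \<in> nodes (wg_quotient \<Gamma> \<kappa>)" "a \<in> A"
    then obtain \<alpha> where "X = \<kappa> `` {\<alpha>}" "\<alpha> \<in> nodes \<Gamma>"
      by (auto simp: wg_quotient_def elim!: quotientE)
    moreover from this obtain \<beta> where "(\<alpha>, a, \<beta>) \<in> edges \<Gamma>"
      using edge_exists \<open>a \<in> A\<close> by blast
    ultimately show "\<exists>Y. (X, a, Y) \<in> edges (wg_quotient \<Gamma> \<kappa>)" by (auto simp: wg_quotient_def)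
  qed
  show "deterministic_wg (wg_quotient \<Gamma> \<kappa>)"
    unfolding deterministic_wg_def
  proof (intro allI impI)
    fix X a Y Y'
    assume "(X, a, Y) \<in> edges (wg_quotient \<Gamma> \<kappa>)" "(X, a, Y') \<in> edges (wg_quotient \<Gamma> \<kappa>)"
    then obtain \<alpha> \<beta> \<alpha>' \<beta>' where e: "(\<alpha>, a, \<beta>) \<in> edges \<Gamma>" "X = \<kappa> `` {\<alpha>}" "Y = \<kappa> `` {\<beta>}"
      and e': "(\<alpha>', a, \<beta>') \<in> edges \<Gamma>" "X = \<kappa> `` {\<alpha>'}" "Y' = \<kappa> `` {\<beta>'}"
      by (auto simp: wg_quotient_def)
    then have "(\<alpha>, \<alpha>') \<in> \<kappa>" using eq_equiv_class[OF _ eq] edge_in by metis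
    then have "(\<beta>, \<beta>') \<in> \<kappa>"
      using \<kappa> e(1) e'(1) unfolding right_invariant_equiv_def targets_related_def by blast
    then show "Y = Y'" using e e' equiv_class_eq[OF eq] by blast
  qed
qed

text \<open>Passing to the quotient creates no new paths: by completeness every word already labels a
  path upstairs, and determinism of the quotient leaves only its image.\<close>

lemma path_to_quotientD:
  assumes \<kappa>: "right_invariant_equiv \<Gamma> \<kappa>" and \<alpha>: "\<alpha> \<in> nodes \<Gamma>"
    and p: "path_to (wg_quotient \<Gamma> \<kappa>) (\<kappa> `` {\<alpha>}) u X"
  obtains \<beta> where "path_to \<Gamma> \<alpha> u \<beta>" "X = \<kappa> `` {\<beta>}"
proof -
  interpret Q: complete_det_graph A "wg_quotient \<Gamma> \<kappa>"
    by (rule complete_det_graph_quotient[OF \<kappa>])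
  obtain \<beta> where b: "path_to \<Gamma> \<alpha> u \<beta>" using path_exists[OF \<alpha>] Q.path_in[OF p] by blast
  moreover have "X = \<kappa> `` {\<beta>}"
    using Q.path_unique[OF p path_to_wg_quotient[OF b]] .
  ultimately show ?thesis by (rule that)
qed

lemma compatible_quotient:
  assumes \<kappa>: "right_invariant_equiv \<Gamma> \<kappa>" and compat: "compatible R \<Gamma>"
  shows "compatible R (wg_quotient \<Gamma> \<kappa>)"
  unfolding compatible_def
proof clarify
  fix u v X Y Y'
  assume uv: "(u, v) \<in> R" and X: "X \<in> nodes (wg_quotient \<Gamma> \<kappa>)"
    and p: "path_to (wg_quotient \<Gamma> \<kappa>) X u Y" "path_to (wg_quotient \<Gamma> \<kappa>) X v Y'"
  from X obtain \<alpha> where \<alpha>: "\<alpha> \<in> nodes \<Gamma>" and X_eq: "X = \<kappa> `` {\<alpha>}"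
    by (auto simp: wg_quotient_def elim: quotientE)
  obtain \<beta> where b: "path_to \<Gamma> \<alpha> u \<beta>" "Y = \<kappa> `` {\<beta>}"
    using path_to_quotientD[OF \<kappa> \<alpha>] p(1) X_eq by blast
  obtain \<beta>' where b': "path_to \<Gamma> \<alpha> v \<beta>'" "Y' = \<kappa> `` {\<beta>'}"
    using path_to_quotientD[OF \<kappa> \<alpha>] p(2) X_eq by blast
  have "\<beta> = \<beta>'" using compat uv \<alpha> b b' unfolding compatible_def by blast
  then show "Y = Y'" using b b' by simp
qed

end

section \<open>The algorithm computes the least right-invariant equivalence\<close>

lemma ex_valid_find:
  assumes "equiv V \<kappa>"
  shows "\<exists>f. valid_find V \<kappa> f"
proof
  show "valid_find V \<kappa> (\<lambda>\<alpha>. SOME \<beta>. \<beta> \<in> \<kappa> `` {\<alpha>})"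
    unfolding valid_find_def
  proof (intro conjI ballI, goal_cases)
    case (1 \<alpha>)
    then have "\<alpha> \<in> \<kappa> `` {\<alpha>}" using equiv_class_self[OF assms] by blast
    then have "(SOME \<beta>. \<beta> \<in> \<kappa> `` {\<alpha>}) \<in> \<kappa> `` {\<alpha>}" by (rule someI)
    then show ?case by simp
  next
    case (2 p)
    then show ?case using equiv_class_eq[OF assms] by (cases p) (simp del: Image_singleton_iff)
  qed
qed

lemma equiv_merge_parts:
  assumes "equiv V \<kappa>" "\<alpha> \<in> V" "\<beta> \<in> V"
  shows "equiv V (merge_parts \<kappa> \<alpha> \<beta>)"
proof (rule equivI)
  have k: "\<kappa> \<subseteq> V \<times> V" "refl_on V \<kappa>" "sym \<kappa>" "trans \<kappa>" using assms(1) by (auto elim: equivE)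
  show "merge_parts \<kappa> \<alpha> \<beta> \<subseteq> V \<times> V" using k(1) by (auto simp: merge_parts_def)
  show "refl_on V (merge_parts \<kappa> \<alpha> \<beta>)" using k(2) by (auto simp: merge_parts_def refl_on_def)
  show "sym (merge_parts \<kappa> \<alpha> \<beta>)" using k(3) by (auto simp: merge_parts_def sym_def)
  show "trans (merge_parts \<kappa> \<alpha> \<beta>)"
  proof (rule transI)
    fix x y w assume "(x, y) \<in> merge_parts \<kappa> \<alpha> \<beta>" "(y, w) \<in> merge_parts \<kappa> \<alpha> \<beta>"
    then show "(x, w) \<in> merge_parts \<kappa> \<alpha> \<beta>"
      unfolding merge_parts_def using symD[OF k(3)] transD[OF k(4)] by blast
  qed
qed

lemma merge_parts_related:
  "equiv V \<kappa> \<Longrightarrow> \<alpha> \<in> V \<Longrightarrow> \<beta> \<in> V \<Longrightarrow> (\<alpha>, \<beta>) \<in> merge_parts \<kappa> \<alpha> \<beta>"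
  by (auto simp: merge_parts_def dest: equiv_class_self)

lemma merge_parts_least:
  assumes "equiv V L" "\<kappa> \<subseteq> L" "(\<alpha>, \<beta>) \<in> L"
  shows "merge_parts \<kappa> \<alpha> \<beta> \<subseteq> L"
proof -
  have L: "sym L" "trans L" using assms(1) by (auto elim: equivE)
  have "(x, y) \<in> L" if "(\<alpha>, x) \<in> \<kappa>" "(\<beta>, y) \<in> \<kappa>" for x y
    using that assms(2,3) symD[OF L(1)] transD[OF L(2)] by (meson subsetD)
  then show ?thesis
    unfolding merge_parts_def using assms(2) symD[OF L(1)] by blast
qed

text \<open>A pair on the stack is pending for all letters, including those outside the alphabet:
  these label no edges, so \<^const>\<open>targets_related\<close> holds vacuously for them.\<close>

definition pending :: "('n \<times> 'n) list \<Rightarrow> ('n \<times> 'n \<times> 'a) set" where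
  "pending S = {(\<alpha>, \<beta>, a). (\<alpha>, \<beta>) \<in> set S}"

text \<open>During a run the partition is not right-invariant. The upper bound \<open>L\<close> stands for any
  partition that a continuation of the run may reach: once the pending triples are settled in
  \<open>L\<close>, the targets of all pairs in \<open>\<kappa>\<close> have to be related in \<open>L\<close>. Quantifying over \<open>L\<close> avoids describing
  the equivalence generated by \<open>\<kappa>\<close> and the pending targets.\<close>

definition right_invariant_up_to ::
    "('n, 'a) word_graph \<Rightarrow> ('n \<times> 'n \<times> 'a) set \<Rightarrow> ('n \<times> 'n) set \<Rightarrow> bool" where
  "right_invariant_up_to \<Gamma> P \<kappa> \<longleftrightarrow>
     (\<forall>L. equiv (nodes \<Gamma>) L \<longrightarrow> \<kappa> \<subseteq> L \<longrightarrow> (\<forall>\<alpha> \<beta> a. (\<alpha>, \<beta>, a) \<in> P \<longrightarrow> targets_related \<Gamma> L \<alpha> \<beta> a) \<longrightarrow>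
        (\<forall>(\<alpha>, \<beta>) \<in> \<kappa>. \<forall>a. targets_related \<Gamma> L \<alpha> \<beta> a))"

text \<open>The set \<open>P\<close> holds the triples that the current pass over the alphabet has still to visit, for
  the pair that was just popped; it is empty between passes.\<close>

definition join_invariant ::
    "('n, 'a) word_graph \<Rightarrow> 'n \<Rightarrow> 'n \<Rightarrow> ('n \<times> 'n \<times> 'a) set \<Rightarrow> 'n join_state \<Rightarrow> bool" where
  "join_invariant \<Gamma> \<zeta>\<^sub>0 \<zeta>\<^sub>1 P s \<longleftrightarrow>
     equiv (nodes \<Gamma>) (partn s) \<and> valid_find (nodes \<Gamma>) (partn s) (find s) \<and>
     set (stack s) \<subseteq> partn s \<and> (\<zeta>\<^sub>0, \<zeta>\<^sub>1) \<in> partn s \<and>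
     right_invariant_up_to \<Gamma> (P \<union> pending (stack s)) (partn s) \<and>
     (\<forall>L. right_invariant_equiv \<Gamma> L \<longrightarrow> (\<zeta>\<^sub>0, \<zeta>\<^sub>1) \<in> L \<longrightarrow> partn s \<subseteq> L)"

lemma right_invariant_up_to_mono:
  assumes "right_invariant_up_to \<Gamma> P \<kappa>"
    and "\<And>L \<alpha> \<beta> a. \<kappa> \<subseteq> L \<Longrightarrow> \<forall>\<alpha> \<beta> a. (\<alpha>, \<beta>, a) \<in> P' \<longrightarrow> targets_related \<Gamma> L \<alpha> \<beta> a \<Longrightarrow>
      (\<alpha>, \<beta>, a) \<in> P \<Longrightarrow> targets_related \<Gamma> L \<alpha> \<beta> a"
  shows "right_invariant_up_to \<Gamma> P' \<kappa>"
  unfolding right_invariant_up_to_def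
proof (intro allI impI)
  fix L assume L: "equiv (nodes \<Gamma>) L" "\<kappa> \<subseteq> L"
    "\<forall>\<alpha> \<beta> a. (\<alpha>, \<beta>, a) \<in> P' \<longrightarrow> targets_related \<Gamma> L \<alpha> \<beta> a"
  have "\<forall>\<alpha> \<beta> a. (\<alpha>, \<beta>, a) \<in> P \<longrightarrow> targets_related \<Gamma> L \<alpha> \<beta> a" using assms(2)[OF L(2,3)] by blast
  then show "\<forall>(\<alpha>, \<beta>) \<in> \<kappa>. \<forall>a. targets_related \<Gamma> L \<alpha> \<beta> a"
    using assms(1) L unfolding right_invariant_up_to_def by blast
qed

context complete_det_graph
begin

lemma targets_related_sym:
  "equiv (nodes \<Gamma>) L \<Longrightarrow> targets_related \<Gamma> L \<alpha> \<beta> a \<Longrightarrow> targets_related \<Gamma> L \<beta> \<alpha> a"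
  unfolding targets_related_def by (meson equivE symD)

lemma targets_related_trans:
  assumes "equiv (nodes \<Gamma>) L" "\<beta> \<in> nodes \<Gamma>"
    and "targets_related \<Gamma> L \<alpha> \<beta> a" "targets_related \<Gamma> L \<beta> \<gamma> a"
  shows "targets_related \<Gamma> L \<alpha> \<gamma> a"
  unfolding targets_related_def
proof (intro allI impI)
  fix \<alpha>' \<gamma>' assume e: "(\<alpha>, a, \<alpha>') \<in> edges \<Gamma>" "(\<gamma>, a, \<gamma>') \<in> edges \<Gamma>"
  obtain \<beta>' where "(\<beta>, a, \<beta>') \<in> edges \<Gamma>" using edge_in edge_exists assms(2) e by blast
  with e assms show "(\<alpha>', \<gamma>') \<in> L"
    unfolding targets_related_def by (meson equivE transD)
qed

text \<open>One pending pair pays for the whole product of the two parts: if \<open>x\<close> lies in the part of \<open>\<alpha>\<close>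
  and \<open>y\<close> in the part of \<open>\<beta>\<close>, then the targets of \<open>x\<close>, \<open>\<alpha>\<close>, \<open>\<beta>\<close>, \<open>y\<close> form a chain of related nodes.\<close>

lemma right_invariant_up_to_merge:
  assumes eq: "equiv (nodes \<Gamma>) \<kappa>" and inv: "right_invariant_up_to \<Gamma> P \<kappa>"
    and nodes: "\<alpha> \<in> nodes \<Gamma>" "\<beta> \<in> nodes \<Gamma>"
  shows "right_invariant_up_to \<Gamma> (P \<union> pending [(\<alpha>, \<beta>)]) (merge_parts \<kappa> \<alpha> \<beta>)"
  unfolding right_invariant_up_to_def
proof (intro allI impI, clarify)
  fix L \<gamma> \<delta> a
  assume L: "equiv (nodes \<Gamma>) L" "merge_parts \<kappa> \<alpha> \<beta> \<subseteq> L"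
    and P: "\<forall>\<gamma> \<delta> a. (\<gamma>, \<delta>, a) \<in> P \<union> pending [(\<alpha>, \<beta>)] \<longrightarrow> targets_related \<Gamma> L \<gamma> \<delta> a"
    and \<gamma>\<delta>: "(\<gamma>, \<delta>) \<in> merge_parts \<kappa> \<alpha> \<beta>"
  have "\<kappa> \<subseteq> L" using L(2) by (auto simp: merge_parts_def)
  then have old: "targets_related \<Gamma> L x y a" if "(x, y) \<in> \<kappa>" for x y
    using inv L P that unfolding right_invariant_up_to_def by blast
  have new: "targets_related \<Gamma> L \<alpha> \<beta> a" using P by (auto simp: pending_def)
  have across: "targets_related \<Gamma> L x y a" if "(\<alpha>, x) \<in> \<kappa>" "(\<beta>, y) \<in> \<kappa>" for x y
    using targets_related_trans[OF L(1) nodes(1) targets_related_sym[OF L(1) old[OF that(1)]]]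
      targets_related_trans[OF L(1) nodes(2) new old[OF that(2)]] by blast
  from \<gamma>\<delta> show "targets_related \<Gamma> L \<gamma> \<delta> a"
    unfolding merge_parts_def using old across targets_related_sym[OF L(1)] by blast
qed

text \<open>The visited triple leaves the pending set because its targets share a part afterwards,
  either already or through the Union. A Union enlarges the partition strictly because distinct
  representatives lie in distinct parts.\<close>

lemma letter_step_invariant:
  assumes inv: "join_invariant \<Gamma> \<zeta>\<^sub>0 \<zeta>\<^sub>1 (insert (\<alpha>\<^sub>0, \<alpha>\<^sub>1, a) P) s"
    and \<alpha>: "(\<alpha>\<^sub>0, \<alpha>\<^sub>1) \<in> partn s"
    and step: "letter_step \<Gamma> \<alpha>\<^sub>0 \<alpha>\<^sub>1 a s s'"
  shows "join_invariant \<Gamma> \<zeta>\<^sub>0 \<zeta>\<^sub>1 P s'" and "s' = s \<or> partn s \<subset> partn s'"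
proof -
  let ?V = "nodes \<Gamma>"
  from inv have eq: "equiv ?V (partn s)" and vf: "valid_find ?V (partn s) (find s)"
    and stk: "set (stack s) \<subseteq> partn s" and z: "(\<zeta>\<^sub>0, \<zeta>\<^sub>1) \<in> partn s"
    and up_to: "right_invariant_up_to \<Gamma> (insert (\<alpha>\<^sub>0, \<alpha>\<^sub>1, a) P \<union> pending (stack s)) (partn s)"
    and least: "\<And>L. right_invariant_equiv \<Gamma> L \<Longrightarrow> (\<zeta>\<^sub>0, \<zeta>\<^sub>1) \<in> L \<Longrightarrow> partn s \<subseteq> L"
    by (auto simp: join_invariant_def)
  from step obtain \<alpha>\<^sub>0' \<alpha>\<^sub>1' where e0: "(\<alpha>\<^sub>0, a, \<alpha>\<^sub>0') \<in> edges \<Gamma>" and e1: "(\<alpha>\<^sub>1, a, \<alpha>\<^sub>1') \<in> edges \<Gamma>"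
    and upd: "if find s \<alpha>\<^sub>0' \<noteq> find s \<alpha>\<^sub>1' then push_union ?V (find s \<alpha>\<^sub>0') (find s \<alpha>\<^sub>1') s s' else s' = s"
    by (auto simp: letter_step_def Let_def)
  define \<gamma>\<^sub>0 \<gamma>\<^sub>1 where "\<gamma>\<^sub>0 = find s \<alpha>\<^sub>0'" and "\<gamma>\<^sub>1 = find s \<alpha>\<^sub>1'"
  have rep: "(\<alpha>\<^sub>0', \<gamma>\<^sub>0) \<in> partn s" "(\<alpha>\<^sub>1', \<gamma>\<^sub>1) \<in> partn s"
    using vf edge_in[OF e0] edge_in[OF e1] by (auto simp: valid_find_def \<gamma>\<^sub>0_def \<gamma>\<^sub>1_def)
  then have nodes: "\<gamma>\<^sub>0 \<in> ?V" "\<gamma>\<^sub>1 \<in> ?V" using eq by (auto elim: equivE)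
  have sym: "sym (partn s)" and trans: "trans (partn s)" using eq by (auto elim: equivE)
  \<comment> \<open>Once \<open>\<alpha>\<^sub>0'\<close> and \<open>\<alpha>\<^sub>1'\<close> share a part, the triple \<open>(\<alpha>\<^sub>0, \<alpha>\<^sub>1, a)\<close> is no longer pending.\<close>
  have resolved: "targets_related \<Gamma> L \<alpha>\<^sub>0 \<alpha>\<^sub>1 a" if "(\<alpha>\<^sub>0', \<alpha>\<^sub>1') \<in> L" for L
    unfolding targets_related_def using that e0 e1 edge_unique by blast
  have "join_invariant \<Gamma> \<zeta>\<^sub>0 \<zeta>\<^sub>1 P s' \<and> (s' = s \<or> partn s \<subset> partn s')"
  proof (cases "\<gamma>\<^sub>0 = \<gamma>\<^sub>1")
    case True
    then have s': "s' = s" using upd by (simp add: \<gamma>\<^sub>0_def \<gamma>\<^sub>1_def)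
    have "(\<alpha>\<^sub>0', \<alpha>\<^sub>1') \<in> partn s" using rep True sym trans by (metis symD transD)
    then have "right_invariant_up_to \<Gamma> (P \<union> pending (stack s)) (partn s)"
      by (intro right_invariant_up_to_mono[OF up_to]) (use resolved in blast)
    then show ?thesis unfolding s' join_invariant_def using eq vf stk z least by blast
  next
    case False
    then have stk': "stack s' = (\<gamma>\<^sub>0, \<gamma>\<^sub>1) # stack s"
      and part': "partn s' = merge_parts (partn s) \<gamma>\<^sub>0 \<gamma>\<^sub>1"
      and vf': "valid_find ?V (partn s') (find s')"
      using upd by (auto simp: push_union_def \<gamma>\<^sub>0_def \<gamma>\<^sub>1_def)
    have eq': "equiv ?V (partn s')" unfolding part' by (rule equiv_merge_parts[OF eq nodes])
    have sub: "partn s \<subseteq> partn s'" by (auto simp: part' merge_parts_def)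
    have rel: "(\<gamma>\<^sub>0, \<gamma>\<^sub>1) \<in> partn s'" unfolding part' by (rule merge_parts_related[OF eq nodes])
    have rel': "(\<alpha>\<^sub>0', \<alpha>\<^sub>1') \<in> partn s'"
      using rep rel sub eq' by (meson equivE subsetD symD transD)
    have "(\<gamma>\<^sub>0, \<gamma>\<^sub>1) \<notin> partn s"
    proof
      assume "(\<gamma>\<^sub>0, \<gamma>\<^sub>1) \<in> partn s"
      then have "(\<alpha>\<^sub>0', \<alpha>\<^sub>1') \<in> partn s" using rep sym trans by (meson symD transD)
      then show False using vf False by (auto simp: valid_find_def \<gamma>\<^sub>0_def \<gamma>\<^sub>1_def)
    qed
    then have strict: "partn s \<subset> partn s'" using sub rel by blast
    have "right_invariant_up_to \<Gamma> (P \<union> pending (stack s')) (partn s')"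
    proof (rule right_invariant_up_to_mono)
      show "right_invariant_up_to \<Gamma>
          (insert (\<alpha>\<^sub>0, \<alpha>\<^sub>1, a) P \<union> pending (stack s) \<union> pending [(\<gamma>\<^sub>0, \<gamma>\<^sub>1)]) (partn s')"
        unfolding part' by (rule right_invariant_up_to_merge[OF eq up_to nodes])
    qed (use resolved rel' in \<open>auto simp: stk' pending_def\<close>)
    moreover have "partn s' \<subseteq> L" if L: "right_invariant_equiv \<Gamma> L" "(\<zeta>\<^sub>0, \<zeta>\<^sub>1) \<in> L" for L
    proof -
      have eqL: "equiv ?V L" using L by (simp add: right_invariant_equiv_def)
      have sub: "partn s \<subseteq> L" using least L by blast
      then have "(\<alpha>\<^sub>0', \<alpha>\<^sub>1') \<in> L"
        using L(1) \<alpha> e0 e1 unfolding right_invariant_equiv_def targets_related_def by blast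
      then have "(\<gamma>\<^sub>0, \<gamma>\<^sub>1) \<in> L" using rep sub eqL by (meson equivE subsetD symD transD)
      then show ?thesis unfolding part' using merge_parts_least[OF eqL sub] by blast
    qed
    ultimately have "join_invariant \<Gamma> \<zeta>\<^sub>0 \<zeta>\<^sub>1 P s'"
      unfolding join_invariant_def using eq' vf' stk z sub rel by (auto simp: stk')
    with strict show ?thesis by blast
  qed
  then show "join_invariant \<Gamma> \<zeta>\<^sub>0 \<zeta>\<^sub>1 P s'" and "s' = s \<or> partn s \<subset> partn s'" by auto
qed

lemma letter_steps_invariant:
  assumes "letter_steps \<Gamma> \<alpha>\<^sub>0 \<alpha>\<^sub>1 as s s'"
    and "join_invariant \<Gamma> \<zeta>\<^sub>0 \<zeta>\<^sub>1 ((\<lambda>a. (\<alpha>\<^sub>0, \<alpha>\<^sub>1, a)) ` set as) s" "(\<alpha>\<^sub>0, \<alpha>\<^sub>1) \<in> partn s"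
  shows "join_invariant \<Gamma> \<zeta>\<^sub>0 \<zeta>\<^sub>1 {} s' \<and> (s' = s \<or> partn s \<subset> partn s')"
  using assms
proof (induction rule: letter_steps.induct)
  case (Nil s)
  then show ?case by simp
next
  case (Cons a s s' as s'')
  have 1: "join_invariant \<Gamma> \<zeta>\<^sub>0 \<zeta>\<^sub>1 ((\<lambda>a. (\<alpha>\<^sub>0, \<alpha>\<^sub>1, a)) ` set as) s'" "s' = s \<or> partn s \<subset> partn s'"
    using letter_step_invariant[OF _ Cons.prems(2) Cons.hyps(1)] Cons.prems(1) by auto
  then have "(\<alpha>\<^sub>0, \<alpha>\<^sub>1) \<in> partn s'" using Cons.prems(2) by blast
  with 1 Cons.IH show ?case by blast
qed

lemma join_step_invariant:
  assumes inv: "join_invariant \<Gamma> \<zeta>\<^sub>0 \<zeta>\<^sub>1 {} s" and step: "join_step A \<Gamma> s s'"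
  shows "join_invariant \<Gamma> \<zeta>\<^sub>0 \<zeta>\<^sub>1 {} s'"
    and "partn s \<subset> partn s' \<or> partn s = partn s' \<and> length (stack s') < length (stack s)"
proof -
  from step obtain \<alpha>\<^sub>0 \<alpha>\<^sub>1 S as where stk: "stack s = (\<alpha>\<^sub>0, \<alpha>\<^sub>1) # S" and as: "set as = A"
    and steps: "letter_steps \<Gamma> \<alpha>\<^sub>0 \<alpha>\<^sub>1 as (s\<lparr>stack := S\<rparr>) s'"
    by (auto simp: join_step_def)
  let ?P = "(\<lambda>a. (\<alpha>\<^sub>0, \<alpha>\<^sub>1, a)) ` set as"
  have up_to: "right_invariant_up_to \<Gamma> (pending (stack s)) (partn s)"
    using inv by (simp add: join_invariant_def)
  have "right_invariant_up_to \<Gamma> (?P \<union> pending S) (partn s)"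
  proof (rule right_invariant_up_to_mono[OF up_to])
    fix L \<alpha> \<beta> and a :: 'a
    assume P: "\<forall>\<alpha> \<beta> a. (\<alpha>, \<beta>, a) \<in> ?P \<union> pending S \<longrightarrow> targets_related \<Gamma> L \<alpha> \<beta> a"
      and "(\<alpha>, \<beta>, a) \<in> pending (stack s)"
    then have "(\<alpha>, \<beta>, a) \<in> ?P \<union> pending S \<or> a \<notin> A" by (auto simp: pending_def stk as)
    then show "targets_related \<Gamma> L \<alpha> \<beta> a"
    proof
      assume "a \<notin> A"
      then show ?thesis using edge_in unfolding targets_related_def by blast
    qed (use P in blast)
  qed
  then have "join_invariant \<Gamma> \<zeta>\<^sub>0 \<zeta>\<^sub>1 ?P (s\<lparr>stack := S\<rparr>)"
    using inv by (auto simp: join_invariant_def stk)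
  moreover have "(\<alpha>\<^sub>0, \<alpha>\<^sub>1) \<in> partn (s\<lparr>stack := S\<rparr>)" using inv by (auto simp: join_invariant_def stk)
  ultimately have "join_invariant \<Gamma> \<zeta>\<^sub>0 \<zeta>\<^sub>1 {} s' \<and>
      (s' = s\<lparr>stack := S\<rparr> \<or> partn (s\<lparr>stack := S\<rparr>) \<subset> partn s')"
    by (rule letter_steps_invariant[OF steps])
  then show "join_invariant \<Gamma> \<zeta>\<^sub>0 \<zeta>\<^sub>1 {} s'"
    and "partn s \<subset> partn s' \<or> partn s = partn s' \<and> length (stack s') < length (stack s)"
    by (auto simp: stk)
qed

lemma join_init_invariant:
  assumes z: "\<zeta>\<^sub>0 \<in> nodes \<Gamma>" "\<zeta>\<^sub>1 \<in> nodes \<Gamma>" and init: "join_init (nodes \<Gamma>) \<zeta>\<^sub>0 \<zeta>\<^sub>1 s"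
  shows "join_invariant \<Gamma> \<zeta>\<^sub>0 \<zeta>\<^sub>1 {} s"
proof -
  let ?V = "nodes \<Gamma>"
  from init have stk: "stack s = [(\<zeta>\<^sub>0, \<zeta>\<^sub>1)]" and part: "partn s = merge_parts (Id_on ?V) \<zeta>\<^sub>0 \<zeta>\<^sub>1"
    and vf: "valid_find ?V (partn s) (find s)"
    by (auto simp: join_init_def push_union_def)
  have eq: "equiv ?V (Id_on ?V)" by (rule equivI) (auto simp: refl_on_def sym_def trans_def)
  have "right_invariant_up_to \<Gamma> {} (Id_on ?V)"
    unfolding right_invariant_up_to_def targets_related_def
    using edge_unique edge_in equiv_class_self by fastforce
  then have "right_invariant_up_to \<Gamma> ({} \<union> pending (stack s)) (partn s)"
    unfolding part stk by (rule right_invariant_up_to_merge[OF eq _ z])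
  moreover have "partn s \<subseteq> L" if "right_invariant_equiv \<Gamma> L" "(\<zeta>\<^sub>0, \<zeta>\<^sub>1) \<in> L" for L
  proof -
    have eqL: "equiv ?V L" using that by (simp add: right_invariant_equiv_def)
    then have "Id_on ?V \<subseteq> L" by (auto elim!: equivE simp: refl_on_def)
    then show ?thesis unfolding part using merge_parts_least[OF eqL] that(2) by blast
  qed
  moreover have "(\<zeta>\<^sub>0, \<zeta>\<^sub>1) \<in> partn s" unfolding part by (rule merge_parts_related[OF eq z])
  moreover have "equiv ?V (partn s)" unfolding part by (rule equiv_merge_parts[OF eq z])
  ultimately show ?thesis using vf by (auto simp: join_invariant_def stk)
qed

lemma run_invariant:
  assumes "\<zeta>\<^sub>0 \<in> nodes \<Gamma>" "\<zeta>\<^sub>1 \<in> nodes \<Gamma>" "join_init (nodes \<Gamma>) \<zeta>\<^sub>0 \<zeta>\<^sub>1 s\<^sub>0" "(join_step A \<Gamma>)\<^sup>*\<^sup>* s\<^sub>0 s"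
  shows "join_invariant \<Gamma> \<zeta>\<^sub>0 \<zeta>\<^sub>1 {} s"
  using assms(4) join_init_invariant[OF assms(1-3)]
  by (induction rule: rtranclp_induct) (auto dest: join_step_invariant(1))

lemma join_init_exists:
  assumes "\<zeta>\<^sub>0 \<in> nodes \<Gamma>" "\<zeta>\<^sub>1 \<in> nodes \<Gamma>"
  shows "\<exists>s. join_init (nodes \<Gamma>) \<zeta>\<^sub>0 \<zeta>\<^sub>1 s"
proof -
  let ?V = "nodes \<Gamma>"
  have eq: "equiv ?V (Id_on ?V)" by (rule equivI) (auto simp: refl_on_def sym_def trans_def)
  obtain f g where "valid_find ?V (Id_on ?V) f" "valid_find ?V (merge_parts (Id_on ?V) \<zeta>\<^sub>0 \<zeta>\<^sub>1) g"
    using ex_valid_find[OF eq] ex_valid_find[OF equiv_merge_parts[OF eq assms]] by blast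
  then have "join_init ?V \<zeta>\<^sub>0 \<zeta>\<^sub>1
      \<lparr>partn = merge_parts (Id_on ?V) \<zeta>\<^sub>0 \<zeta>\<^sub>1, find = g, stack = [(\<zeta>\<^sub>0, \<zeta>\<^sub>1)]\<rparr>"
    by (auto simp: join_init_def push_union_def)
  then show ?thesis by blast
qed

text \<open>A pass gets stuck only if a target is missing or no representative function exists for the
  new partition; completeness excludes the first, and \<open>ex_valid_find\<close> the second.\<close>

lemma letter_steps_exist:
  assumes "equiv (nodes \<Gamma>) (partn s)" "valid_find (nodes \<Gamma>) (partn s) (find s)"
    and "\<alpha>\<^sub>0 \<in> nodes \<Gamma>" "\<alpha>\<^sub>1 \<in> nodes \<Gamma>" "set as \<subseteq> A"
  shows "\<exists>s'. letter_steps \<Gamma> \<alpha>\<^sub>0 \<alpha>\<^sub>1 as s s'"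
  using assms
proof (induction as arbitrary: s)
  case Nil
  then show ?case by (blast intro: letter_steps.Nil)
next
  case (Cons a as)
  let ?V = "nodes \<Gamma>"
  obtain \<alpha>\<^sub>0' \<alpha>\<^sub>1' where e: "(\<alpha>\<^sub>0, a, \<alpha>\<^sub>0') \<in> edges \<Gamma>" "(\<alpha>\<^sub>1, a, \<alpha>\<^sub>1') \<in> edges \<Gamma>"
    using edge_exists Cons.prems by fastforce
  define \<gamma>\<^sub>0 \<gamma>\<^sub>1 where "\<gamma>\<^sub>0 = find s \<alpha>\<^sub>0'" and "\<gamma>\<^sub>1 = find s \<alpha>\<^sub>1'"
  have "(\<alpha>\<^sub>0', \<gamma>\<^sub>0) \<in> partn s" "(\<alpha>\<^sub>1', \<gamma>\<^sub>1) \<in> partn s"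
    using Cons.prems(2) edge_in[OF e(1)] edge_in[OF e(2)]
    by (auto simp: valid_find_def \<gamma>\<^sub>0_def \<gamma>\<^sub>1_def)
  then have nodes: "\<gamma>\<^sub>0 \<in> ?V" "\<gamma>\<^sub>1 \<in> ?V" using Cons.prems(1) by (auto elim: equivE)
  have eq': "equiv ?V (merge_parts (partn s) \<gamma>\<^sub>0 \<gamma>\<^sub>1)"
    by (rule equiv_merge_parts[OF Cons.prems(1) nodes])
  then obtain g where g: "valid_find ?V (merge_parts (partn s) \<gamma>\<^sub>0 \<gamma>\<^sub>1) g"
    using ex_valid_find by blast
  define s' where "s' = (if \<gamma>\<^sub>0 \<noteq> \<gamma>\<^sub>1
    then \<lparr>partn = merge_parts (partn s) \<gamma>\<^sub>0 \<gamma>\<^sub>1, find = g, stack = (\<gamma>\<^sub>0, \<gamma>\<^sub>1) # stack s\<rparr> else s)"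
  have step: "letter_step \<Gamma> \<alpha>\<^sub>0 \<alpha>\<^sub>1 a s s'"
    unfolding letter_step_def Let_def
    by (intro exI conjI, rule e, rule e)
      (auto simp: s'_def push_union_def g simp flip: \<gamma>\<^sub>0_def \<gamma>\<^sub>1_def)
  have "\<exists>s''. letter_steps \<Gamma> \<alpha>\<^sub>0 \<alpha>\<^sub>1 as s' s''"
    by (rule Cons.IH) (use Cons.prems eq' g in \<open>auto simp: s'_def\<close>)
  with step show ?case by (blast intro: letter_steps.Cons)
qed

lemma join_step_exists:
  assumes fin: "finite A" and inv: "join_invariant \<Gamma> \<zeta>\<^sub>0 \<zeta>\<^sub>1 {} s" and "stack s \<noteq> []"
  shows "\<exists>s'. join_step A \<Gamma> s s'"
proof -
  obtain \<alpha>\<^sub>0 \<alpha>\<^sub>1 S where stk: "stack s = (\<alpha>\<^sub>0, \<alpha>\<^sub>1) # S" using assms(3) by (cases "stack s") auto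
  obtain as where as: "set as = A" "distinct as" using finite_distinct_list[OF fin] by blast
  have "(\<alpha>\<^sub>0, \<alpha>\<^sub>1) \<in> partn s" "equiv (nodes \<Gamma>) (partn s)"
    using inv by (auto simp: join_invariant_def stk)
  then have "\<alpha>\<^sub>0 \<in> nodes \<Gamma>" "\<alpha>\<^sub>1 \<in> nodes \<Gamma>" by (auto elim: equivE)
  then have "\<exists>s'. letter_steps \<Gamma> \<alpha>\<^sub>0 \<alpha>\<^sub>1 as (s\<lparr>stack := S\<rparr>) s'"
    by (intro letter_steps_exist) (use inv as in \<open>auto simp: join_invariant_def\<close>)
  then show ?thesis unfolding join_step_def using stk as by blast
qed

text \<open>A pass can push many pairs, so the stack alone does not shrink; but a pass that pushes also
  relates new nodes, of which there are finitely many pairs. The measure is therefore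
  lexicographic: first the number of unrelated pairs, then the height of the stack.\<close>

lemma no_infinite_run:
  assumes fin: "finite (nodes \<Gamma>)" and inv: "join_invariant \<Gamma> \<zeta>\<^sub>0 \<zeta>\<^sub>1 {} (s 0)"
    and steps: "\<And>i. join_step A \<Gamma> (s i) (s (Suc i))"
  shows False
proof -
  let ?V = "nodes \<Gamma>"
  let ?m = "\<lambda>s. (card (?V \<times> ?V - partn s), length (stack s))"
  have invs: "join_invariant \<Gamma> \<zeta>\<^sub>0 \<zeta>\<^sub>1 {} (s i)" for i
    by (induction i) (use inv steps join_step_invariant(1) in blast)+
  have "(?m (s (Suc i)), ?m (s i)) \<in> less_than <*lex*> less_than" for i
  proof -
    have "partn (s (Suc i)) \<subseteq> ?V \<times> ?V"
      using invs[of "Suc i"] by (auto simp: join_invariant_def elim: equivE)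
    then have "card (?V \<times> ?V - partn (s (Suc i))) < card (?V \<times> ?V - partn (s i))"
      if "partn (s i) \<subset> partn (s (Suc i))"
      using that fin by (intro psubset_card_mono) auto
    then show ?thesis using join_step_invariant(2)[OF invs steps, of i] by auto
  qed
  then have "\<exists>f. \<forall>i. (f (Suc i), f i) \<in> less_than <*lex*> less_than"
    by (intro exI[of _ "\<lambda>i. ?m (s i)"]) blast
  moreover have "wf (less_than <*lex*> less_than)" by auto
  ultimately show False unfolding wf_iff_no_infinite_down_chain by blast
qed

text \<open>An empty stack leaves nothing pending, so the partition itself may serve as the upper bound
  in \<^const>\<open>right_invariant_up_to\<close>.\<close>

lemma final_partition:
  assumes inv: "join_invariant \<Gamma> \<zeta>\<^sub>0 \<zeta>\<^sub>1 {} s" and "stack s = []"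
  shows "right_invariant_equiv \<Gamma> (partn s)" "(\<zeta>\<^sub>0, \<zeta>\<^sub>1) \<in> partn s"
    and "right_invariant_equiv \<Gamma> L \<Longrightarrow> (\<zeta>\<^sub>0, \<zeta>\<^sub>1) \<in> L \<Longrightarrow> partn s \<subseteq> L"
  using assms
  by (auto simp: join_invariant_def right_invariant_equiv_def right_invariant_up_to_def pending_def)

end

section \<open>Disjoint unions\<close>

lemma path_to_wg_union_Inl:
  "path_to \<Gamma>\<^sub>0 x u y \<Longrightarrow> path_to (wg_union \<Gamma>\<^sub>0 \<Gamma>\<^sub>1) (Inl x) u (Inl y)"
  by (induction rule: path_to.induct) (auto intro!: path_to.intros simp: wg_union_def)

lemma path_to_wg_union_Inr:
  "path_to \<Gamma>\<^sub>1 x u y \<Longrightarrow> path_to (wg_union \<Gamma>\<^sub>0 \<Gamma>\<^sub>1) (Inr x) u (Inr y)"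
  by (induction rule: path_to.induct) (auto intro!: path_to.intros simp: wg_union_def)

lemma complete_det_graph_union:
  assumes "complete_det_graph A \<Gamma>\<^sub>0" "complete_det_graph A \<Gamma>\<^sub>1"
  shows "complete_det_graph A (wg_union \<Gamma>\<^sub>0 \<Gamma>\<^sub>1)"
proof -
  interpret G0: complete_det_graph A \<Gamma>\<^sub>0 by fact
  interpret G1: complete_det_graph A \<Gamma>\<^sub>1 by fact
  show ?thesis
  proof
    show "word_graph_over A (wg_union \<Gamma>\<^sub>0 \<Gamma>\<^sub>1)"
      using G0.edge_in G1.edge_in by (auto simp: word_graph_over_def wg_union_def)
    show "complete_wg A (wg_union \<Gamma>\<^sub>0 \<Gamma>\<^sub>1)"
      using G0.edge_exists G1.edge_exists by (fastforce simp: complete_wg_def wg_union_def)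
    show "deterministic_wg (wg_union \<Gamma>\<^sub>0 \<Gamma>\<^sub>1)"
      using G0.edge_unique G1.edge_unique by (fastforce simp: deterministic_wg_def wg_union_def)
  qed
qed

lemma compatible_union:
  assumes "complete_det_graph A \<Gamma>\<^sub>0" "complete_det_graph A \<Gamma>\<^sub>1"
    and "compatible R \<Gamma>\<^sub>0" "compatible R \<Gamma>\<^sub>1"
  shows "compatible R (wg_union \<Gamma>\<^sub>0 \<Gamma>\<^sub>1)"
proof -
  interpret G0: complete_det_graph A \<Gamma>\<^sub>0 by fact
  interpret G1: complete_det_graph A \<Gamma>\<^sub>1 by fact
  interpret G: complete_det_graph A "wg_union \<Gamma>\<^sub>0 \<Gamma>\<^sub>1"
    by (rule complete_det_graph_union[OF assms(1,2)])
  show ?thesis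
    unfolding compatible_def
  proof clarify
    fix u v \<alpha> \<beta> \<beta>'
    assume uv: "(u, v) \<in> R" and \<alpha>: "\<alpha> \<in> nodes (wg_union \<Gamma>\<^sub>0 \<Gamma>\<^sub>1)"
      and p: "path_to (wg_union \<Gamma>\<^sub>0 \<Gamma>\<^sub>1) \<alpha> u \<beta>" and p': "path_to (wg_union \<Gamma>\<^sub>0 \<Gamma>\<^sub>1) \<alpha> v \<beta>'"
    have words: "u \<in> lists A" "v \<in> lists A" using G.path_in p p' by blast+
    show "\<beta> = \<beta>'"
    proof (cases \<alpha>)
      case (Inl x)
      then have x: "x \<in> nodes \<Gamma>\<^sub>0" using \<alpha> by (auto simp: wg_union_def)
      obtain y y' where y: "path_to \<Gamma>\<^sub>0 x u y" "path_to \<Gamma>\<^sub>0 x v y'"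
        using G0.path_exists[OF x] words by blast
      then have "y = y'" using assms(3) uv x unfolding compatible_def by blast
      then show ?thesis using path_to_wg_union_Inl y p p' G.path_unique Inl by metis
    next
      case (Inr x)
      then have x: "x \<in> nodes \<Gamma>\<^sub>1" using \<alpha> by (auto simp: wg_union_def)
      obtain y y' where y: "path_to \<Gamma>\<^sub>1 x u y" "path_to \<Gamma>\<^sub>1 x v y'"
        using G1.path_exists[OF x] words by blast
      then have "y = y'" using assms(4) uv x unfolding compatible_def by blast
      then show ?thesis using path_to_wg_union_Inr y p p' G.path_unique Inr by metis
    qed
  qed
qed

section \<open>Joins of right congruences\<close>

lemma right_congruence_join:
  assumes "monoid M" "right_congruence M \<rho>\<^sub>0" "right_congruence M \<rho>\<^sub>1"
  shows "right_congruence M (right_congruence_join M \<rho>\<^sub>0 \<rho>\<^sub>1)"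
proof -
  let ?F = "{r. right_congruence M r \<and> \<rho>\<^sub>0 \<union> \<rho>\<^sub>1 \<subseteq> r}"
  interpret monoid M by fact
  have "equiv (carrier M) (carrier M \<times> carrier M)"
    by (rule equivI) (auto simp: refl_on_def sym_def trans_def)
  \<comment> \<open>The universal relation shows that the intersection is taken over a non-empty family.\<close>
  then have top: "carrier M \<times> carrier M \<in> ?F"
    using assms(2,3) by (auto simp: right_congruence_def elim: equivE)
  have eq: "equiv (carrier M) r" if "r \<in> ?F" for r using that by (simp add: right_congruence_def)
  have "equiv (carrier M) (\<Inter> ?F)"
  proof (rule equivI)
    show "\<Inter> ?F \<subseteq> carrier M \<times> carrier M" using top by blast
    show "refl_on (carrier M) (\<Inter> ?F)" using eq unfolding refl_on_def by (meson InterI equivE refl_onD)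
    show "sym (\<Inter> ?F)" using eq unfolding sym_def by (meson InterI InterE equivE symD)
    show "trans (\<Inter> ?F)" using eq unfolding trans_def by (meson InterI InterE equivE transD)
  qed
  moreover have "(x \<otimes>\<^bsub>M\<^esub> s, y \<otimes>\<^bsub>M\<^esub> s) \<in> \<Inter> ?F" if "(x, y) \<in> \<Inter> ?F" "s \<in> carrier M" for x y s
    using that unfolding right_congruence_def by blast
  ultimately show ?thesis
    unfolding right_congruence_join_def right_congruence_def[of M "\<Inter> ?F"] by blast
qed

lemma right_congruence_join_least:
  "right_congruence M r \<Longrightarrow> \<rho>\<^sub>0 \<subseteq> r \<Longrightarrow> \<rho>\<^sub>1 \<subseteq> r \<Longrightarrow> right_congruence_join M \<rho>\<^sub>0 \<rho>\<^sub>1 \<subseteq> r"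
  by (auto simp: right_congruence_join_def)

lemma representsD:
  assumes "represents A R M \<theta> \<Gamma> z \<rho>"
  shows "complete_det_graph A \<Gamma>" "z \<in> nodes \<Gamma>" "compatible R \<Gamma>" "right_congruence M \<rho>"
    and "\<alpha> \<in> nodes \<Gamma> \<Longrightarrow> \<exists>u. path_to \<Gamma> z u \<alpha>" "\<rho> = map_prod \<theta> \<theta> ` path_rel \<Gamma> z"
  using assms by (auto simp: represents_def complete_det_graph_def)

definition reaching_words ::
    "('v, 'a) word_graph \<Rightarrow> 'v \<Rightarrow> ('w, 'a) word_graph \<Rightarrow> 'w \<Rightarrow> 'v + 'w \<Rightarrow> 'a list set" where
  "reaching_words \<Gamma>\<^sub>0 z\<^sub>0 \<Gamma>\<^sub>1 z\<^sub>1 \<alpha> =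
     (case \<alpha> of Inl x \<Rightarrow> {u. path_to \<Gamma>\<^sub>0 z\<^sub>0 u x} | Inr y \<Rightarrow> {u. path_to \<Gamma>\<^sub>1 z\<^sub>1 u y})"

definition pullback_to_nodes where
  "pullback_to_nodes \<theta> r \<Gamma>\<^sub>0 z\<^sub>0 \<Gamma>\<^sub>1 z\<^sub>1 =
     {(\<alpha>, \<beta>) \<in> nodes (wg_union \<Gamma>\<^sub>0 \<Gamma>\<^sub>1) \<times> nodes (wg_union \<Gamma>\<^sub>0 \<Gamma>\<^sub>1).
        \<forall>u \<in> reaching_words \<Gamma>\<^sub>0 z\<^sub>0 \<Gamma>\<^sub>1 z\<^sub>1 \<alpha>. \<forall>v \<in> reaching_words \<Gamma>\<^sub>0 z\<^sub>0 \<Gamma>\<^sub>1 z\<^sub>1 \<beta>. (\<theta> u, \<theta> v) \<in> r}"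

text \<open>Reflexivity is where the inclusions of \<open>\<rho>\<^sub>0\<close> and \<open>\<rho>\<^sub>1\<close> in \<open>r\<close> enter: two words reaching the same node of \<open>\<Gamma>\<^sub>0\<close> are
  related by \<open>\<rho>\<^sub>0\<close>, and similarly for \<open>\<Gamma>\<^sub>1\<close>, hence related by \<open>r\<close>. Transitivity also needs that every
  node is reached by some word, and right-invariance comes from multiplying by a letter.\<close>

lemma pullback_right_invariant:
  assumes pres: "presented_by A R M \<theta>"
    and rep0: "represents A R M \<theta> \<Gamma>\<^sub>0 z\<^sub>0 \<rho>\<^sub>0" and rep1: "represents A R M \<theta> \<Gamma>\<^sub>1 z\<^sub>1 \<rho>\<^sub>1"
    and r: "right_congruence M r" and sub: "\<rho>\<^sub>0 \<subseteq> r" "\<rho>\<^sub>1 \<subseteq> r"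
  defines "L \<equiv> pullback_to_nodes \<theta> r \<Gamma>\<^sub>0 z\<^sub>0 \<Gamma>\<^sub>1 z\<^sub>1"
  shows "right_invariant_equiv (wg_union \<Gamma>\<^sub>0 \<Gamma>\<^sub>1) L" and "(Inl z\<^sub>0, Inr z\<^sub>1) \<in> L"
proof -
  interpret G0: complete_det_graph A \<Gamma>\<^sub>0 by (rule representsD(1)[OF rep0])
  interpret G1: complete_det_graph A \<Gamma>\<^sub>1 by (rule representsD(1)[OF rep1])
  let ?\<Gamma> = "wg_union \<Gamma>\<^sub>0 \<Gamma>\<^sub>1" and ?W = "reaching_words \<Gamma>\<^sub>0 z\<^sub>0 \<Gamma>\<^sub>1 z\<^sub>1"
  interpret G: complete_det_graph A ?\<Gamma>
    by (rule complete_det_graph_union[OF G0.complete_det_graph_axioms G1.complete_det_graph_axioms])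
  have r_sym: "sym r" and r_trans: "trans r" using r by (auto simp: right_congruence_def elim: equivE)
  have W_ex: "\<exists>u. u \<in> ?W \<alpha>" if "\<alpha> \<in> nodes ?\<Gamma>" for \<alpha>
    using that representsD(5)[OF rep0] representsD(5)[OF rep1]
    by (auto simp: wg_union_def reaching_words_def)
  have W_words: "u \<in> lists A" if "u \<in> ?W \<alpha>" for u \<alpha>
    using that G0.path_in G1.path_in by (auto simp: reaching_words_def split: sum.splits)
  have W_snoc: "u @ [a] \<in> ?W \<alpha>'" if "u \<in> ?W \<alpha>" "(\<alpha>, a, \<alpha>') \<in> edges ?\<Gamma>" for u \<alpha> a \<alpha>'
    using that G0.edge_in G1.edge_in
    by (auto simp: reaching_words_def wg_union_def intro!: path_to_snoc)
  have path_sub0: "(\<theta> u, \<theta> v) \<in> r" if "path_to \<Gamma>\<^sub>0 z\<^sub>0 u x" "path_to \<Gamma>\<^sub>0 z\<^sub>0 v x" for u v x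
    using that sub(1) unfolding representsD(6)[OF rep0] by (force simp: path_rel_def)
  have path_sub1: "(\<theta> u, \<theta> v) \<in> r" if "path_to \<Gamma>\<^sub>1 z\<^sub>1 u x" "path_to \<Gamma>\<^sub>1 z\<^sub>1 v x" for u v x
    using that sub(2) unfolding representsD(6)[OF rep1] by (force simp: path_rel_def)
  have same: "(\<theta> u, \<theta> v) \<in> r" if "u \<in> ?W \<alpha>" "v \<in> ?W \<alpha>" for u v \<alpha>
    using that path_sub0 path_sub1 by (auto simp: reaching_words_def split: sum.splits)
  \<comment> \<open>Since words reaching one node are \<open>r\<close>-related, one pair of words decides about a pair of nodes.\<close>
  have LI: "(\<alpha>, \<beta>) \<in> L"
    if "\<alpha> \<in> nodes ?\<Gamma>" "\<beta> \<in> nodes ?\<Gamma>" "u \<in> ?W \<alpha>" "v \<in> ?W \<beta>" "(\<theta> u, \<theta> v) \<in> r" for \<alpha> \<beta> u v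
  proof -
    have "(\<theta> u', \<theta> v') \<in> r" if "u' \<in> ?W \<alpha>" "v' \<in> ?W \<beta>" for u' v'
      using same[OF that(1) \<open>u \<in> ?W \<alpha>\<close>] same[OF \<open>v \<in> ?W \<beta>\<close> that(2)] \<open>(\<theta> u, \<theta> v) \<in> r\<close> r_trans
      by (meson transD)
    with that show ?thesis by (auto simp: L_def pullback_to_nodes_def)
  qed
  have LD: "(\<theta> u, \<theta> v) \<in> r" if "(\<alpha>, \<beta>) \<in> L" "u \<in> ?W \<alpha>" "v \<in> ?W \<beta>" for \<alpha> \<beta> u v
    using that by (auto simp: L_def pullback_to_nodes_def)
  have L_nodes: "L \<subseteq> nodes ?\<Gamma> \<times> nodes ?\<Gamma>" by (auto simp: L_def pullback_to_nodes_def)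
  have "equiv (nodes ?\<Gamma>) L"
  proof (rule equivI)
    show "L \<subseteq> nodes ?\<Gamma> \<times> nodes ?\<Gamma>" by (rule L_nodes)
    show "refl_on (nodes ?\<Gamma>) L" unfolding refl_on_def using LI W_ex same by blast
    show "sym L" unfolding L_def pullback_to_nodes_def sym_def using r_sym by (auto dest: symD)
    show "trans L"
    proof (rule transI)
      fix \<alpha> \<beta> \<gamma> assume L: "(\<alpha>, \<beta>) \<in> L" "(\<beta>, \<gamma>) \<in> L"
      then have nodes: "\<alpha> \<in> nodes ?\<Gamma>" "\<beta> \<in> nodes ?\<Gamma>" "\<gamma> \<in> nodes ?\<Gamma>" using L_nodes by auto
      then obtain u v w where w: "u \<in> ?W \<alpha>" "v \<in> ?W \<beta>" "w \<in> ?W \<gamma>" using W_ex by metis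
      have "(\<theta> u, \<theta> w) \<in> r" using transD[OF r_trans] LD[OF L(1) w(1,2)] LD[OF L(2) w(2,3)] .
      then show "(\<alpha>, \<gamma>) \<in> L" by (rule LI[OF nodes(1,3) w(1,3)])
    qed
  qed
  moreover have "(\<alpha>', \<beta>') \<in> L"
    if L: "(\<alpha>, \<beta>) \<in> L" and e: "(\<alpha>, a, \<alpha>') \<in> edges ?\<Gamma>" "(\<beta>, a, \<beta>') \<in> edges ?\<Gamma>" for \<alpha> \<beta> a \<alpha>' \<beta>'
  proof -
    obtain u v where uv: "u \<in> ?W \<alpha>" "v \<in> ?W \<beta>" using W_ex L L_nodes by blast
    have a: "[a] \<in> lists A" using G.edge_in[OF e(1)] by simp
    then have "\<theta> [a] \<in> carrier M" using pres by (auto simp: presented_by_def)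
    then have "(\<theta> u \<otimes>\<^bsub>M\<^esub> \<theta> [a], \<theta> v \<otimes>\<^bsub>M\<^esub> \<theta> [a]) \<in> r"
      using LD[OF L uv] r unfolding right_congruence_def by blast
    then have "(\<theta> (u @ [a]), \<theta> (v @ [a])) \<in> r"
      using presented_by_append[OF pres _ a] W_words uv by metis
    then show ?thesis using LI W_snoc uv e G.edge_in by blast
  qed
  ultimately show "right_invariant_equiv ?\<Gamma> L"
    by (auto simp: right_invariant_equiv_def targets_related_def)
  have "[] \<in> ?W (Inl z\<^sub>0)" "[] \<in> ?W (Inr z\<^sub>1)" "Inl z\<^sub>0 \<in> nodes ?\<Gamma>" "Inr z\<^sub>1 \<in> nodes ?\<Gamma>"
    using representsD(2)[OF rep0] representsD(2)[OF rep1]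
    by (auto simp: reaching_words_def wg_union_def intro: path_to.Nil)
  then show "(Inl z\<^sub>0, Inr z\<^sub>1) \<in> L" using LI same by blast
qed

text \<open>The two inclusions use the two properties of \<open>\<kappa>\<close>: right-invariance makes the quotient
  deterministic, so that its path relation is a right congruence above \<open>\<rho>\<^sub>0\<close> and \<open>\<rho>\<^sub>1\<close>; leastness
  puts \<open>\<kappa>\<close> below the pullback of every such right congruence.\<close>

lemma quotient_represents_join:
  assumes R: "R \<subseteq> lists A \<times> lists A" and pres: "presented_by A R M \<theta>"
    and rep0: "represents A R M \<theta> \<Gamma>\<^sub>0 z\<^sub>0 \<rho>\<^sub>0" and rep1: "represents A R M \<theta> \<Gamma>\<^sub>1 z\<^sub>1 \<rho>\<^sub>1"
    and \<kappa>: "right_invariant_equiv (wg_union \<Gamma>\<^sub>0 \<Gamma>\<^sub>1) \<kappa>" and z: "(Inl z\<^sub>0, Inr z\<^sub>1) \<in> \<kappa>"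
    and least: "\<And>L. right_invariant_equiv (wg_union \<Gamma>\<^sub>0 \<Gamma>\<^sub>1) L \<Longrightarrow> (Inl z\<^sub>0, Inr z\<^sub>1) \<in> L \<Longrightarrow> \<kappa> \<subseteq> L"
  shows "represents A R M \<theta> (wg_quotient (wg_union \<Gamma>\<^sub>0 \<Gamma>\<^sub>1) \<kappa>) (\<kappa> `` {Inl z\<^sub>0})
    (right_congruence_join M \<rho>\<^sub>0 \<rho>\<^sub>1)"
proof -
  let ?\<Gamma> = "wg_union \<Gamma>\<^sub>0 \<Gamma>\<^sub>1" and ?z = "\<kappa> `` {Inl z\<^sub>0}" and ?J = "right_congruence_join M \<rho>\<^sub>0 \<rho>\<^sub>1"
  let ?Q = "wg_quotient ?\<Gamma> \<kappa>"
  interpret G0: complete_det_graph A \<Gamma>\<^sub>0 by (rule representsD(1)[OF rep0])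
  interpret G: complete_det_graph A ?\<Gamma>
    by (rule complete_det_graph_union[OF representsD(1)[OF rep0] representsD(1)[OF rep1]])
  interpret Q: complete_det_graph A ?Q by (rule G.complete_det_graph_quotient[OF \<kappa>])
  have eq: "equiv (nodes ?\<Gamma>) \<kappa>" using \<kappa> by (simp add: right_invariant_equiv_def)
  have z0: "Inl z\<^sub>0 \<in> nodes ?\<Gamma>" using z eq by (auto elim: equivE)
  have z_eq: "?z = \<kappa> `` {Inr z\<^sub>1}" using equiv_class_eq[OF eq z] .
  have z_node: "?z \<in> nodes ?Q" using z0 by (simp add: wg_quotient_def quotientI)
  have path0: "path_to ?Q ?z u (\<kappa> `` {Inl x})" if "path_to \<Gamma>\<^sub>0 z\<^sub>0 u x" for u x
    by (rule path_to_wg_quotient[OF path_to_wg_union_Inl[OF that]])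
  have path1: "path_to ?Q ?z u (\<kappa> `` {Inr y})" if "path_to \<Gamma>\<^sub>1 z\<^sub>1 u y" for u y
    unfolding z_eq by (rule path_to_wg_quotient[OF path_to_wg_union_Inr[OF that]])
  have compat: "compatible R ?Q"
    by (rule G.compatible_quotient[OF \<kappa> compatible_union[OF representsD(1)[OF rep0]
      representsD(1)[OF rep1] representsD(3)[OF rep0] representsD(3)[OF rep1]]])
  have reach: "\<exists>u. path_to ?Q ?z u X" if X: "X \<in> nodes ?Q" for X
  proof -
    obtain \<alpha> where \<alpha>: "\<alpha> \<in> nodes ?\<Gamma>" "X = \<kappa> `` {\<alpha>}"
      using X by (auto simp: wg_quotient_def elim: quotientE)
    show ?thesis
    proof (cases \<alpha>)
      case (Inl x)
      then have "x \<in> nodes \<Gamma>\<^sub>0" using \<alpha>(1) by (auto simp: wg_union_def)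
      then show ?thesis using representsD(5)[OF rep0] path0 \<alpha>(2) Inl by blast
    next
      case (Inr y)
      then have "y \<in> nodes \<Gamma>\<^sub>1" using \<alpha>(1) by (auto simp: wg_union_def)
      then show ?thesis using representsD(5)[OF rep1] path1 \<alpha>(2) Inr by blast
    qed
  qed
  have "?J = map_prod \<theta> \<theta> ` path_rel ?Q ?z"
  proof
    show "?J \<subseteq> map_prod \<theta> \<theta> ` path_rel ?Q ?z"
    proof (rule right_congruence_join_least)
      show "right_congruence M (map_prod \<theta> \<theta> ` path_rel ?Q ?z)"
        by (rule Q.right_congruence_path_rel[OF R compat pres z_node])
      show "\<rho>\<^sub>0 \<subseteq> map_prod \<theta> \<theta> ` path_rel ?Q ?z"
        unfolding representsD(6)[OF rep0] path_rel_def using path0 by blast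
      show "\<rho>\<^sub>1 \<subseteq> map_prod \<theta> \<theta> ` path_rel ?Q ?z"
        unfolding representsD(6)[OF rep1] path_rel_def using path1 by blast
    qed
    show "map_prod \<theta> \<theta> ` path_rel ?Q ?z \<subseteq> ?J"
    proof clarify
      fix u v assume "(u, v) \<in> path_rel ?Q ?z"
      then obtain X where X: "path_to ?Q ?z u X" "path_to ?Q ?z v X" by (auto simp: path_rel_def)
      \<comment> \<open>Lifting both words to \<open>\<Gamma>\<^sub>0\<close> turns the common node of the quotient into a pair in \<open>\<kappa>\<close>.\<close>
      obtain x y where xy: "path_to \<Gamma>\<^sub>0 z\<^sub>0 u x" "path_to \<Gamma>\<^sub>0 z\<^sub>0 v y"
        using G0.path_exists[OF representsD(2)[OF rep0]] Q.path_in[OF X(1)] Q.path_in[OF X(2)]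
        by metis
      have "\<kappa> `` {Inl x} = \<kappa> `` {Inl y}" using Q.path_unique path0 xy X by metis
      moreover have "Inl y \<in> nodes ?\<Gamma>" using G0.path_in[OF xy(2)] by (auto simp: wg_union_def)
      ultimately have xy\<kappa>: "(Inl x, Inl y) \<in> \<kappa>" using eq_equiv_class[OF _ eq] by blast
      have "(\<theta> u, \<theta> v) \<in> r" if r: "right_congruence M r" "\<rho>\<^sub>0 \<subseteq> r" "\<rho>\<^sub>1 \<subseteq> r" for r
      proof -
        note L = pullback_right_invariant[OF pres rep0 rep1 r]
        have "(Inl x, Inl y) \<in> pullback_to_nodes \<theta> r \<Gamma>\<^sub>0 z\<^sub>0 \<Gamma>\<^sub>1 z\<^sub>1" using least[OF L] xy\<kappa> by blast
        then show ?thesis using xy by (auto simp: pullback_to_nodes_def reaching_words_def)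
      qed
      then show "(\<theta> u, \<theta> v) \<in> ?J" by (auto simp: right_congruence_join_def)
    qed
  qed
  moreover have "right_congruence M ?J"
    using right_congruence_join pres representsD(4)[OF rep0] representsD(4)[OF rep1]
    by (auto simp: presented_by_def)
  ultimately show ?thesis
    unfolding represents_def using Q.over Q.complete Q.det z_node compat reach by blast
qed

theorem proposition6p3:
  fixes A :: "'a set" and R :: "('a list \<times> 'a list) set"
    and M :: "('m, 'x) monoid_scheme" and \<theta> :: "'a list \<Rightarrow> 'm"
    and \<Gamma>\<^sub>0 :: "('v, 'a) word_graph" and z\<^sub>0 :: 'v and \<rho>\<^sub>0 :: "('m \<times> 'm) set"
    and \<Gamma>\<^sub>1 :: "('w, 'a) word_graph" and z\<^sub>1 :: 'w and \<rho>\<^sub>1 :: "('m \<times> 'm) set"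
  assumes "finite A" and "R \<subseteq> lists A \<times> lists A"
    and "presented_by A R M \<theta>"
    and "finite (nodes \<Gamma>\<^sub>0)" and "represents A R M \<theta> \<Gamma>\<^sub>0 z\<^sub>0 \<rho>\<^sub>0"
    and "finite (nodes \<Gamma>\<^sub>1)" and "represents A R M \<theta> \<Gamma>\<^sub>1 z\<^sub>1 \<rho>\<^sub>1"
  shows "join_terminates A \<Gamma>\<^sub>0 z\<^sub>0 \<Gamma>\<^sub>1 z\<^sub>1 \<and>
    (\<forall>\<kappa>. join_final_partition A \<Gamma>\<^sub>0 z\<^sub>0 \<Gamma>\<^sub>1 z\<^sub>1 \<kappa> \<longrightarrow>
       represents A R M \<theta> (wg_quotient (wg_union \<Gamma>\<^sub>0 \<Gamma>\<^sub>1) \<kappa>) (\<kappa> `` {Inl z\<^sub>0})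
         (right_congruence_join M \<rho>\<^sub>0 \<rho>\<^sub>1))"
proof -
  let ?\<Gamma> = "wg_union \<Gamma>\<^sub>0 \<Gamma>\<^sub>1"
  interpret G: complete_det_graph A ?\<Gamma>
    by (rule complete_det_graph_union[OF representsD(1)[OF assms(5)] representsD(1)[OF assms(7)]])
  have z: "Inl z\<^sub>0 \<in> nodes ?\<Gamma>" "Inr z\<^sub>1 \<in> nodes ?\<Gamma>"
    using representsD(2)[OF assms(5)] representsD(2)[OF assms(7)] by (auto simp: wg_union_def)
  have fin: "finite (nodes ?\<Gamma>)" using assms(4,6) by (simp add: wg_union_def)
  have inv: "join_invariant ?\<Gamma> (Inl z\<^sub>0) (Inr z\<^sub>1) {} s" if "join_reachable A \<Gamma>\<^sub>0 z\<^sub>0 \<Gamma>\<^sub>1 z\<^sub>1 s" for s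
    using that G.run_invariant[OF z] by (auto simp: join_reachable_def)
  have "join_terminates A \<Gamma>\<^sub>0 z\<^sub>0 \<Gamma>\<^sub>1 z\<^sub>1"
    unfolding join_terminates_def
  proof (intro conjI)
    show "\<exists>s. join_reachable A \<Gamma>\<^sub>0 z\<^sub>0 \<Gamma>\<^sub>1 z\<^sub>1 s"
      using G.join_init_exists[OF z] by (auto simp: join_reachable_def)
    show "\<nexists>s. join_reachable A \<Gamma>\<^sub>0 z\<^sub>0 \<Gamma>\<^sub>1 z\<^sub>1 (s 0) \<and> (\<forall>i. join_step A ?\<Gamma> (s i) (s (Suc i)))"
      using G.no_infinite_run[OF fin inv] by blast
    show "\<forall>s. join_reachable A \<Gamma>\<^sub>0 z\<^sub>0 \<Gamma>\<^sub>1 z\<^sub>1 s \<longrightarrow> stack s \<noteq> [] \<longrightarrow> (\<exists>s'. join_step A ?\<Gamma> s s')"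
      using G.join_step_exists[OF assms(1) inv] by blast
  qed
  moreover have "represents A R M \<theta> (wg_quotient ?\<Gamma> \<kappa>) (\<kappa> `` {Inl z\<^sub>0}) (right_congruence_join M \<rho>\<^sub>0 \<rho>\<^sub>1)"
    if "join_final_partition A \<Gamma>\<^sub>0 z\<^sub>0 \<Gamma>\<^sub>1 z\<^sub>1 \<kappa>" for \<kappa>
  proof -
    from that obtain s where s: "join_reachable A \<Gamma>\<^sub>0 z\<^sub>0 \<Gamma>\<^sub>1 z\<^sub>1 s" "stack s = []" "partn s = \<kappa>"
      by (auto simp: join_final_partition_def)
    note final = G.final_partition[OF inv[OF s(1)] s(2), unfolded s(3)]
    show ?thesis by (rule quotient_represents_join[OF assms(2,3,5,7) final])
  qed
  ultimately show ?thesis by blast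
qed

end
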